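(* Suppose there exist $P_i\succ0$, $Q_i\succcurlyeq0$ ($n\times n$, $i\in\mathcal I$) and $\Pi=[\pi_{i,j}]_{i,j\in\mathcal I}\in\mathcal M$ satisfying $$A_i^\top P_i+P_iA_i+\sum_{j\in\mathcal I}\pi_{j,i}P_j+Q_i\prec0\qquad\forall i\in\mathcal I .$$ Then the switched feedback law $\sigma(x)=\min\{\operatorname{argmin}_{i\in\mathcal I}x^\top P_ix\}$ makes $x^*=0$ globally asymptotically stable for the switched system $\dot x=A_\sigma x$. Moreover, it holds that $$\int_0^\infty x^\top Q_{\alpha(x)}\,x\,dt<\min_{i\in\mathcal I}x(0)^\top P_ix(0),\qquad Q_{\alpha(x)}:=\sum_{i\in\mathrm I(x)}\alpha_i(x)Q_i ,$$ where $\alpha_i(x)$ are the weights in the representation of $\dot x$ along the solution.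
   Context: $\mathcal I=\{1,\dots,N\}$, $A_i\in\mathbb R^{n\times n}$ for $i\in\mathcal I$. $\mathcal M:=\{\Pi\in\mathbb R^{N\times N}\mid \pi_{i,j}\ge0\ \forall i\ne j,\ \sum_{i=1}^N\pi_{i,j}=0\ \forall j\}$. Solution concept (Filippov-type, allowing sliding motions). Put $\mathcal X_i:=\{x\in\mathbb R^n\mid\sigma(x)=i\}$, $\mathrm I(x):=\{i\in\mathcal I\mid$ every neighborhood of $x$ meets $\mathcal X_i\}$, $\dot v_i(x,\xi):=x^\top P_i\xi+\xi^\top P_ix$. A solution of the closed loop is an absolutely continuous $x:\mathbb R_{\ge0}\to\mathbb R^n$ such that, for almost all $t$, with $x=x(t)$, $$\dot x(t)=\sum_{i\in\mathrm I(x)}\alpha_i(x)A_ix\quad\text{and}\quad\dot v_{\sigma(x)}\Big(x,\sum_{i\in\mathrm I(x)}\alpha_i(x)A_ix\Big)\le\sum_{i\in\mathrm I(x)}\dot v_i(x,\alpha_i(x)A_ix)$$ for some weights $\alpha_i(x)\ge0$ ($i\in\mathrm I(x)$) with $\sum_{i\in\mathrm I(x)}\alpha_i(x)=1$. Without loss of generality the weights are taken such that $t\mapsto\alpha_i(x(t))$ is almost everywhere continuous, which ensures integrability in the bound. Existence of solutions in this sense is assumed wherever needed, and stability is with respect to such solutions.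
   Formalization: The strict integral bound is stated only for x(0) ≠ 0; for x(0) = 0 the only solution is x = 0 and both sides equal 0, so the strict inequality fails there. *)

theory Defs
  imports "HOL-Analysis.Analysis"
begin

text \<open>Definiteness is understood for symmetric matrices.\<close>

definition pos_def :: "real^'n^'n \<Rightarrow> bool" where
  "pos_def M \<longleftrightarrow> transpose M = M \<and> (\<forall>x. x \<noteq> 0 \<longrightarrow> 0 < x \<bullet> (M *v x))"

definition pos_semidef :: "real^'n^'n \<Rightarrow> bool" where
  "pos_semidef M \<longleftrightarrow> transpose M = M \<and> (\<forall>x. 0 \<le> x \<bullet> (M *v x))"

definition neg_def :: "real^'n^'n \<Rightarrow> bool" where
  "neg_def M \<longleftrightarrow> transpose M = M \<and> (\<forall>x. x \<noteq> 0 \<longrightarrow> x \<bullet> (M *v x) < 0)"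

text \<open>The index set is \<open>{1..N}\<close>; values of indexed families at other naturals are irrelevant.\<close>

definition Metzler_zero_colsum :: "nat \<Rightarrow> (nat \<Rightarrow> nat \<Rightarrow> real) set" where
  "Metzler_zero_colsum N =
     {p. (\<forall>i\<in>{1..N}. \<forall>j\<in>{1..N}. i \<noteq> j \<longrightarrow> 0 \<le> p i j) \<and> (\<forall>j\<in>{1..N}. (\<Sum>i=1..N. p i j) = 0)}"

definition switching_law :: "nat \<Rightarrow> (nat \<Rightarrow> real^'n^'n) \<Rightarrow> real^'n \<Rightarrow> nat" where
  "switching_law N P x = Min {i. is_arg_min (\<lambda>i. x \<bullet> (P i *v x)) (\<lambda>i. i \<in> {1..N}) i}"

definition active_modes :: "nat \<Rightarrow> (real^'n \<Rightarrow> nat) \<Rightarrow> real^'n \<Rightarrow> nat set" where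
  "active_modes N \<sigma> x = {i\<in>{1..N}. \<forall>U. open U \<and> x \<in> U \<longrightarrow> U \<inter> {y. \<sigma> y = i} \<noteq> {}}"

definition vdot :: "(nat \<Rightarrow> real^'n^'n) \<Rightarrow> nat \<Rightarrow> real^'n \<Rightarrow> real^'n \<Rightarrow> real" where
  "vdot P i x \<xi> = x \<bullet> (P i *v \<xi>) + \<xi> \<bullet> (P i *v x)"

definition absolutely_continuous_fun_on :: "real set \<Rightarrow> (real \<Rightarrow> 'a::metric_space) \<Rightarrow> bool" where
  "absolutely_continuous_fun_on S f \<longleftrightarrow>
     (\<forall>\<epsilon>>0. \<exists>\<delta>>0. \<forall>D. finite D \<and> (\<forall>(a, b)\<in>D. a < b \<and> {a..b} \<subseteq> S) \<and>
        disjoint_family_on (\<lambda>(a, b). {a<..<b}) D \<and> (\<Sum>(a, b)\<in>D. b - a) < \<delta>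
        \<longrightarrow> (\<Sum>(a, b)\<in>D. dist (f a) (f b)) < \<epsilon>)"

text \<open>\<open>a\<close> is a family of weights representing the velocity \<open>\<xi>\<close> at the state \<open>y\<close>;
  only the values \<open>a i\<close> with \<open>i\<close> active at \<open>y\<close> matter.\<close>

definition represents_velocity ::
  "nat \<Rightarrow> (nat \<Rightarrow> real^'n^'n) \<Rightarrow> (nat \<Rightarrow> real^'n^'n) \<Rightarrow> (real^'n \<Rightarrow> nat) \<Rightarrow>
   real^'n \<Rightarrow> real^'n \<Rightarrow> (nat \<Rightarrow> real) \<Rightarrow> bool" where
  "represents_velocity N A P \<sigma> y \<xi> a \<longleftrightarrow>
     (\<forall>i\<in>active_modes N \<sigma> y. 0 \<le> a i) \<and>
     (\<Sum>i\<in>active_modes N \<sigma> y. a i) = 1 \<and>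
     \<xi> = (\<Sum>i\<in>active_modes N \<sigma> y. a i *\<^sub>R (A i *v y)) \<and>
     vdot P (\<sigma> y) y (\<Sum>i\<in>active_modes N \<sigma> y. a i *\<^sub>R (A i *v y))
       \<le> (\<Sum>i\<in>active_modes N \<sigma> y. vdot P i y (a i *\<^sub>R (A i *v y)))"

text \<open>Absolute continuity on the half line is meant on every compact interval, as usual for
  Caratheodory and Filippov solutions. Values of \<open>x\<close> at negative times are irrelevant.\<close>

definition closed_loop_solution ::
  "nat \<Rightarrow> (nat \<Rightarrow> real^'n^'n) \<Rightarrow> (nat \<Rightarrow> real^'n^'n) \<Rightarrow> (real^'n \<Rightarrow> nat) \<Rightarrow>
   (real \<Rightarrow> real^'n) \<Rightarrow> bool" where
  "closed_loop_solution N A P \<sigma> x \<longleftrightarrow>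
     (\<forall>T>0. absolutely_continuous_fun_on {0..T} x) \<and>
     (AE t in lebesgue. 0 \<le> t \<longrightarrow>
        (\<exists>\<xi> a. (x has_vector_derivative \<xi>) (at t within {0..}) \<and>
               represents_velocity N A P \<sigma> (x t) \<xi> a))"

text \<open>State-dependent weights along the solution \<open>x\<close>. As \<open>\<alpha> i y\<close> is meaningful only for
  \<open>i\<close> active at \<open>y\<close>, almost everywhere continuity of \<open>t \<mapsto> \<alpha> i (x t)\<close> is required
  relative to the times at which \<open>i\<close> is active.\<close>

definition solution_weights ::
  "nat \<Rightarrow> (nat \<Rightarrow> real^'n^'n) \<Rightarrow> (nat \<Rightarrow> real^'n^'n) \<Rightarrow> (real^'n \<Rightarrow> nat) \<Rightarrow>
   (real \<Rightarrow> real^'n) \<Rightarrow> (nat \<Rightarrow> real^'n \<Rightarrow> real) \<Rightarrow> bool" where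
  "solution_weights N A P \<sigma> x \<alpha> \<longleftrightarrow>
     (AE t in lebesgue. 0 \<le> t \<longrightarrow>
        (\<exists>\<xi>. (x has_vector_derivative \<xi>) (at t within {0..}) \<and>
             represents_velocity N A P \<sigma> (x t) \<xi> (\<lambda>i. \<alpha> i (x t)))) \<and>
     (\<forall>i\<in>{1..N}. AE t in lebesgue. 0 \<le> t \<and> i \<in> active_modes N \<sigma> (x t) \<longrightarrow>
        continuous (at t within {s. 0 \<le> s \<and> i \<in> active_modes N \<sigma> (x s)}) (\<lambda>s. \<alpha> i (x s)))"

definition weighted_cost ::
  "nat \<Rightarrow> (real^'n \<Rightarrow> nat) \<Rightarrow> (nat \<Rightarrow> real^'n^'n) \<Rightarrow> (nat \<Rightarrow> real^'n \<Rightarrow> real) \<Rightarrow>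
   real^'n \<Rightarrow> real^'n^'n" where
  "weighted_cost N \<sigma> Q \<alpha> y = (\<Sum>i\<in>active_modes N \<sigma> y. \<alpha> i y *\<^sub>R Q i)"

text \<open>\<open>S\<close> is the set of solutions, given as a predicate on functions of time \<open>t \<ge> 0\<close>.\<close>

definition globally_asymptotically_stable ::
  "((real \<Rightarrow> 'a::real_normed_vector) \<Rightarrow> bool) \<Rightarrow> 'a \<Rightarrow> bool" where
  "globally_asymptotically_stable S x\<^sub>e \<longleftrightarrow>
     S (\<lambda>_. x\<^sub>e) \<and>
     (\<forall>\<epsilon>>0. \<exists>\<delta>>0. \<forall>x. S x \<and> dist (x 0) x\<^sub>e < \<delta> \<longrightarrow> (\<forall>t\<ge>0. dist (x t) x\<^sub>e < \<epsilon>)) \<and>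
     (\<forall>x. S x \<longrightarrow> (x \<longlongrightarrow> x\<^sub>e) at_top)"

end

theory Submission
  imports Defs
begin

text \<open>
  The minimum \<open>V\<close> of the forms \<open>x\<^sup>T P\<^sub>i x\<close> is a Lyapunov function. Along a solution \<open>V\<close> is absolutely
  continuous, and for almost every \<open>t\<close> its derivative is that of the form selected by the switching
  law, since forms crossing with different slopes do so only at isolated times. The condition on
  the weights bounds this derivative by the weighted sum of the derivatives of the active modes,
  every active mode attains the minimum, and the Metzler structure makes the coupling terms
  nonnegative at such modes. Hence \<open>V' \<le> - c |x|\<^sup>2 - x\<^sup>T Q\<^sub>\<alpha> x\<close> almost everywhere with a uniform
  \<open>c > 0\<close>, and integration gives both claims; for convergence, monotonicity of \<open>V\<close> turns the
  integrated inequality into \<open>V(T) (1 + k T) \<le> V(0)\<close>.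
\<close>

text \<open>Two obstacles shape the proof. During sliding the trajectory stays on a switching
  surface, so several forms may attain the minimum on a set of times of positive measure. Ties are
  thus not exceptional; only ties with different slopes are. Moreover the velocity then mixes
  several modes, whereas the matrix inequality for mode \<open>i\<close> controls only the field of
  \<open>A i\<close> measured by \<open>P i\<close>. Mixed terms, the form of \<open>P i\<close>
  along the field of \<open>A j\<close>, have no definite sign; the inequality imposed on the
  weights replaces them by unmixed ones.

  Integration uses the gauge integral: the derivative of an absolutely continuous function, known
  only almost everywhere, is integrable as part of the fundamental theorem. The constant
  \<open>c\<close> comes from strict definiteness on the compact unit sphere and from the finiteness
  of the set of modes. Besides convergence it yields the strictness of the cost bound: the integral
  of \<open>c |x|^2\<close> over the times from 0 to 1 is a positive margin when
  \<open>x 0 \<noteq> 0\<close>.\<close>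

section \<open>Fundamental theorem of calculus for absolutely continuous functions\<close>

lemma negligible_open_superset:
  fixes S :: "'a::euclidean_space set"
  assumes "negligible S" "0 < e"
  obtains U where "open U" "S \<subseteq> U" "U \<in> lmeasurable" "measure lebesgue U < e"
proof -
  have S: "S \<in> null_sets lebesgue"
    using assms(1) by (simp add: negligible_iff_null_sets)
  then obtain U where U: "open U" "S \<subseteq> U" "U - S \<in> lmeasurable" "emeasure lebesgue (U - S) < ennreal e"
    using sets_lebesgue_outer_open[of S e] assms(2) by (metis null_setsD2)
  have "emeasure lebesgue U = emeasure lebesgue (U - S)"
    using S U(1) by (metis borel_open emeasure_Diff_null_set sets_completionI_sets sets_lborel)
  with U(4) have eU: "emeasure lebesgue U < ennreal e" by simp
  have "U \<in> sets lebesgue" using U(1) by auto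
  then have Um: "U \<in> lmeasurable"
    using eU by (auto intro!: fmeasurableI intro: order_less_trans[OF _ ennreal_less_top])
  have "measure lebesgue U < e"
    using eU Um assms(2) by (simp add: emeasure_eq_measure2 ennreal_less_iff)
  with U Um that show ?thesis by blast
qed

lemma tagged_partial_division_interval:
  fixes a b :: real
  assumes "p tagged_partial_division_of {a..b}" "(t, K) \<in> p"
  shows "K = {Inf K..Sup K}" "Inf K \<le> Sup K"
proof -
  obtain u v where K: "K = {u..v}" using tagged_partial_division_ofD(4)[OF assms] by auto
  moreover have "u \<le> v" using tagged_partial_division_ofD(2)[OF assms] K by auto
  ultimately show "K = {Inf K..Sup K}" "Inf K \<le> Sup K" by simp_all
qed

text \<open>Absolute continuity is defined by the total length of nondegenerate intervals, while a
  gauge argument produces tagged intervals inside a small open set. The bridge: disjoint interiors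
  of intervals lying in \<open>U\<close> have total length at most the measure of
  \<open>U\<close>.\<close>

lemma absolutely_continuous_tagged_sum:
  fixes g :: "real \<Rightarrow> 'a::metric_space"
  assumes "absolutely_continuous_fun_on {a..b} g" "0 < \<epsilon>"
  obtains \<delta> where "0 < \<delta>"
    "\<And>p U. \<lbrakk>p tagged_partial_division_of {a..b}; U \<in> lmeasurable; measure lebesgue U < \<delta>;
       \<And>t K. (t, K) \<in> p \<Longrightarrow> K \<subseteq> U\<rbrakk> \<Longrightarrow> (\<Sum>(t, K)\<in>p. dist (g (Inf K)) (g (Sup K))) < \<epsilon>"
proof -
  from assms(1)[unfolded absolutely_continuous_fun_on_def, rule_format, OF assms(2)]
  obtain \<delta> where \<delta>: "0 < \<delta>" and ac: "\<And>D. finite D \<and> (\<forall>(u, v)\<in>D. u < v \<and> {u..v} \<subseteq> {a..b}) \<and>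
        disjoint_family_on (\<lambda>(u, v). {u<..<v}) D \<and> (\<Sum>(u, v)\<in>D. v - u) < \<delta>
        \<Longrightarrow> (\<Sum>(u, v)\<in>D. dist (g u) (g v)) < \<epsilon>"
    by blast
  have "(\<Sum>(t, K)\<in>p. dist (g (Inf K)) (g (Sup K))) < \<epsilon>"
    if p: "p tagged_partial_division_of {a..b}"
    and U: "U \<in> lmeasurable" "measure lebesgue U < \<delta>" "\<And>t K. (t, K) \<in> p \<Longrightarrow> K \<subseteq> U" for p U
  proof -
    \<comment> \<open>A tagged division may contain one-point intervals, which the definition of
      absolute continuity does not admit; they contribute 0 to the sum.\<close>
    define q where "q = {(t, K) \<in> p. Inf K < Sup K}"
    define h where "h = (\<lambda>(t::real, K::real set). (Inf K, Sup K))"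
    note pD = tagged_partial_division_ofD[OF p]
    have K: "K = {Inf K..Sup K} \<and> Inf K \<le> Sup K" if "(t, K) \<in> p" for t K
      using tagged_partial_division_interval[OF p that] by blast
    have qp: "q \<subseteq> p" and finq: "finite q"
      using pD(1) by (auto simp: q_def intro: finite_subset)
    have int: "interior K = {Inf K<..<Sup K}" if "(t, K) \<in> p" for t K
      using K[OF that] by (metis interior_atLeastAtMost_real)
    have disj: "{Inf K<..<Sup K} \<inter> {Inf L<..<Sup L} = {}"
      if "(s, K) \<in> q" "(t, L) \<in> q" "(s, K) \<noteq> (t, L)" for s t K L
      using pD(5)[of s K t L] that qp int[of s K] int[of t L] by auto
    \<comment> \<open>Passing to endpoint pairs must not merge summands: an interval carrying two
      tags would overlap itself, which its nonempty interior forbids.\<close>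
    have inj: "inj_on h q"
    proof (rule inj_onI, clarify)
      fix s K t L assume *: "(s, K) \<in> q" "(t, L) \<in> q" "h (s, K) = h (t, L)"
      have "{Inf K<..<Sup K} \<noteq> {}"
        using *(1) by (auto simp: q_def)
      with * disj[of s K t L] show "s = t \<and> K = L"
        by (auto simp: h_def)
    qed
    have "(\<Sum>(t, K)\<in>p. dist (g (Inf K)) (g (Sup K))) = (\<Sum>(t, K)\<in>q. dist (g (Inf K)) (g (Sup K)))"
    proof (rule sum.mono_neutral_right[OF pD(1) qp], clarify)
      fix t K assume "(t, K) \<in> p" "(t, K) \<notin> q"
      with K[of t K] have "Inf K = Sup K" by (auto simp: q_def)
      then show "dist (g (Inf K)) (g (Sup K)) = 0" by simp
    qed
    also have "\<dots> = (\<Sum>(u, v)\<in>h ` q. dist (g u) (g v))"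
      by (subst sum.reindex[OF inj]) (auto simp: h_def intro!: sum.cong)
    also have "\<dots> < \<epsilon>"
    proof (rule ac, intro conjI)
      show "finite (h ` q)" using finq by simp
      show "\<forall>(u, v)\<in>h ` q. u < v \<and> {u..v} \<subseteq> {a..b}"
      proof clarify
        fix u v t K assume *: "(u, v) = h (t, K)" "(t, K) \<in> q"
        then have tK: "(t, K) \<in> p" "Inf K < Sup K" by (auto simp: q_def)
        have "{Inf K..Sup K} \<subseteq> {a..b}" using K[OF tK(1)] pD(3)[OF tK(1)] by metis
        then show "u < v \<and> {u..v} \<subseteq> {a..b}" using * tK by (simp add: h_def)
      qed
      show dj: "disjoint_family_on (\<lambda>(u, v). {u<..<v}) (h ` q)"
        unfolding disjoint_family_on_def
      proof (intro ballI impI)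
        fix i j assume "i \<in> h ` q" "j \<in> h ` q" "i \<noteq> j"
        then obtain s K t L where "(s, K) \<in> q" "(t, L) \<in> q" "i = h (s, K)" "j = h (t, L)" "(s, K) \<noteq> (t, L)"
          by auto
        with disj[of s K t L] show "(case i of (u, v) \<Rightarrow> {u<..<v}) \<inter> (case j of (u, v) \<Rightarrow> {u<..<v}) = {}"
          by (simp add: h_def)
      qed
      let ?I = "\<lambda>(u, v). {u<..<v::real}"
      have "(\<Sum>(u, v)\<in>h ` q. v - u) = (\<Sum>i\<in>h ` q. measure lebesgue (?I i))"
        by (rule sum.cong) (auto simp: h_def q_def)
      also have "\<dots> = measure lebesgue (\<Union>i\<in>h ` q. ?I i)"
        by (rule measure_UNION'[symmetric])
           (use finq dj in \<open>auto simp: disjoint_family_on_def pairwise_def disjnt_def split: prod.splits\<close>)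
      also have "\<dots> \<le> measure lebesgue U"
      proof (rule measure_mono_fmeasurable)
        show "(\<Union>i\<in>h ` q. ?I i) \<subseteq> U"
        proof
          fix x assume "x \<in> (\<Union>i\<in>h ` q. ?I i)"
          then obtain t K where "(t, K) \<in> p" and "x \<in> {Inf K..Sup K}" using qp by (auto simp: h_def)
          then show "x \<in> U" using U(3) K by (metis subsetD)
        qed
        show "(\<Union>i\<in>h ` q. ?I i) \<in> sets lebesgue"
          using finq by (intro sets.finite_UN) auto
      qed (use U in auto)
      finally show "(\<Sum>(u, v)\<in>h ` q. v - u) < \<delta>" using U(2) by simp
    qed
    finally show ?thesis .
  qed
  with \<delta> that show ?thesis by blast
qed

lemma fundamental_theorem_of_calculus_absolutely_continuous:
  fixes g :: "real \<Rightarrow> 'a::banach"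
  assumes ab: "a \<le> b" and ac: "absolutely_continuous_fun_on {a..b} g" and Z: "negligible Z"
    and der: "\<And>t. t \<in> {a..b} - Z \<Longrightarrow> (g has_vector_derivative f t) (at t within {a..b})"
  shows "(f has_integral (g b - g a)) {a..b}"
proof -
  \<comment> \<open>\<open>f\<close> is arbitrary on \<open>Z\<close>; with the value 0 there, the
    error at a tag in \<open>Z\<close> is just an increment of \<open>g\<close>.\<close>
  define f0 where "f0 = (\<lambda>t. if t \<in> Z then 0 else f t)"
  have "(f0 has_integral (g b - g a)) {a..b}"
    unfolding has_integral_real
  proof (intro allI impI)
    fix e :: real assume e: "0 < e"
    \<comment> \<open>Half of \<open>e\<close> is reserved for the tags in \<open>Z\<close>. The
      summand 1 keeps the denominator positive when \<open>a = b\<close> and makes the second bound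
      strict.\<close>
    define \<eta> where "\<eta> = e / (2 * (b - a + 1))"
    have \<eta>: "0 < \<eta>" "\<eta> * (b - a) < e / 2"
      using e ab by (auto simp: \<eta>_def field_simps)
    obtain \<delta> where \<delta>: "0 < \<delta>" and acD: "\<And>p U. \<lbrakk>p tagged_partial_division_of {a..b}; U \<in> lmeasurable;
         measure lebesgue U < \<delta>; \<And>t K. (t, K) \<in> p \<Longrightarrow> K \<subseteq> U\<rbrakk>
         \<Longrightarrow> (\<Sum>(t, K)\<in>p. dist (g (Inf K)) (g (Sup K))) < e / 2"
      using absolutely_continuous_tagged_sum[OF ac half_gt_zero[OF e]] by blast
    obtain U where U: "open U" "Z \<subseteq> U" "U \<in> lmeasurable" "measure lebesgue U < \<delta>"
      using negligible_open_superset[OF Z \<delta>] by blast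
    \<comment> \<open>Tags in \<open>Z\<close> get intervals inside \<open>U\<close>, where the oscillation of \<open>g\<close> is controlled by absolute
      continuity; at all other tags differentiability is used as in the classical proof.\<close>
    have "\<exists>d>0. (t \<in> Z \<longrightarrow> ball t d \<subseteq> U) \<and> (t \<in> {a..b} - Z \<longrightarrow>
         (\<forall>s\<in>{a..b}. norm (s-t) < d \<longrightarrow> norm (g s - g t - (s-t) *\<^sub>R f t) \<le> \<eta> * norm (s-t)))" for t
    proof (cases "t \<in> {a..b} - Z")
      case True
      then show ?thesis
        using der[OF True] \<eta>(1)
        unfolding has_vector_derivative_def has_derivative_within_alt by blast
    next
      case False
      show ?thesis
      proof (cases "t \<in> Z")
        case True
        then show ?thesis using U(1,2) openE[of U t] by blast
      next
        case False
        with \<open>t \<notin> {a..b} - Z\<close> show ?thesis by (intro exI[of _ 1]) auto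
      qed
    qed
    then obtain d where d: "\<And>t. d t > 0" "\<And>t. t \<in> Z \<Longrightarrow> ball t (d t) \<subseteq> U"
      "\<And>t s. \<lbrakk>t \<in> {a..b} - Z; s \<in> {a..b}; norm (s-t) < d t\<rbrakk> \<Longrightarrow>
         norm (g s - g t - (s-t) *\<^sub>R f t) \<le> \<eta> * norm (s-t)"
      by metis
    show "\<exists>\<gamma>. gauge \<gamma> \<and> (\<forall>\<D>. \<D> tagged_division_of {a..b} \<and> \<gamma> fine \<D> \<longrightarrow>
            norm ((\<Sum>(t, K)\<in>\<D>. measure lborel K *\<^sub>R f0 t) - (g b - g a)) < e)"
    proof (intro exI conjI allI impI)
      show "gauge (\<lambda>t. ball t (d t))" using d(1) by (rule gauge_ball_dependent[rule_format])
      fix p assume "p tagged_division_of {a..b} \<and> (\<lambda>t. ball t (d t)) fine p"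
      then have p: "p tagged_division_of {a..b}" and fine: "\<And>t K. (t, K) \<in> p \<Longrightarrow> K \<subseteq> ball t (d t)"
        by (auto simp: fine_def)
      note pD = tagged_division_ofD[OF p]
      have pp: "p tagged_partial_division_of {a..b}" using p by (simp add: tagged_division_of_def)
      have K: "K = {Inf K..Sup K} \<and> Inf K \<le> Sup K" if "(t, K) \<in> p" for t K
        using tagged_partial_division_interval[OF pp that] by blast
      define p1 where "p1 = {(t, K) \<in> p. t \<in> Z}"
      have p1: "p1 \<subseteq> p" "finite p1" using pD(1) by (auto simp: p1_def intro: finite_subset)
      have sum1: "(\<Sum>(t, K)\<in>p1. dist (g (Inf K)) (g (Sup K))) < e / 2"
      proof (rule acD[OF _ U(3,4)])
        show "p1 tagged_partial_division_of {a..b}"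
          using pp p1(1) by (rule tagged_partial_division_subset)
        show "K \<subseteq> U" if "(t, K) \<in> p1" for t K
          using that fine[of t K] d(2)[of t] by (auto simp: p1_def)
      qed
      let ?E = "\<lambda>(t, K). measure lborel K *\<^sub>R f0 t - (g (Sup K) - g (Inf K))"
      have n1: "norm (sum ?E p1) < e / 2"
      proof -
        have "norm (sum ?E p1) \<le> (\<Sum>(t, K)\<in>p1. dist (g (Inf K)) (g (Sup K)))"
          by (rule sum_norm_le) (auto simp: p1_def f0_def dist_norm)
        then show ?thesis using sum1 by simp
      qed
      have n2: "norm (sum ?E (p - p1)) \<le> (\<Sum>(t, K)\<in>p - p1. \<eta> * (Sup K - Inf K))"
      proof (rule sum_norm_le, clarsimp)
        fix t K assume tK: "(t, K) \<in> p" "(t, K) \<notin> p1"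
        then have t: "t \<in> {a..b} - Z" using pD(2,3)[OF tK(1)] by (auto simp: p1_def)
        define u v where "u = Inf K" and "v = Sup K"
        have Kuv: "K = {u..v}" "u \<le> v" using K[OF tK(1)] by (auto simp: u_def v_def)
        then have uv: "u \<in> K" "v \<in> K" "u \<le> t" "t \<le> v" using pD(2)[OF tK(1)] by auto
        have b: "norm (g s - g t - (s-t) *\<^sub>R f t) \<le> \<eta> * norm (s-t)" if "s \<in> K" for s
          using d(3)[OF t, of s] that fine[OF tK(1)] pD(3)[OF tK(1)]
          by (auto simp: subset_iff dist_real_def abs_minus_commute)
        \<comment> \<open>The tag lies between the endpoints, so the errors of the linear
          approximation at \<open>u\<close> and at \<open>v\<close> are bounded together by
          \<open>\<eta> * (v - u)\<close>.\<close>
        have "measure lborel K *\<^sub>R f0 t - (g v - g u)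
              = (g u - g t - (u-t) *\<^sub>R f t) - (g v - g t - (v-t) *\<^sub>R f t)"
          using Kuv t by (simp add: f0_def algebra_simps)
        then have "norm (measure lborel K *\<^sub>R f0 t - (g v - g u)) \<le> \<eta> * norm (u-t) + \<eta> * norm (v-t)"
          using b[OF uv(1)] b[OF uv(2)] by (smt (verit) norm_triangle_ineq4)
        also have "\<dots> = \<eta> * (v - u)" using uv by (simp add: algebra_simps)
        finally show "norm (measure lborel K *\<^sub>R f0 t - (g (Sup K) - g (Inf K))) \<le> \<eta> * (Sup K - Inf K)"
          by (simp add: u_def v_def)
      qed
      also have "\<dots> \<le> (\<Sum>(t, K)\<in>p. \<eta> * (Sup K - Inf K))"
        by (rule sum_mono2) (use pD(1) K \<eta> in \<open>auto intro!: mult_nonneg_nonneg\<close>)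
      also have "\<dots> = \<eta> * (b - a)"
        using additive_tagged_division_1[OF ab p, of "\<lambda>x. x"]
        by (simp add: sum_distrib_left[symmetric] case_prod_unfold)
      finally have n2: "norm (sum ?E (p - p1)) < e / 2" using \<eta>(2) by simp
      have "(\<Sum>(t, K)\<in>p. measure lborel K *\<^sub>R f0 t) - (g b - g a) = sum ?E p"
        using additive_tagged_division_1[OF ab p, of g]
        by (simp add: sum_subtractf case_prod_unfold)
      also have "\<dots> = sum ?E (p - p1) + sum ?E p1"
        by (rule sum.subset_diff[OF p1(1) pD(1)])
      finally have "norm ((\<Sum>(t, K)\<in>p. measure lborel K *\<^sub>R f0 t) - (g b - g a))
          \<le> norm (sum ?E (p - p1)) + norm (sum ?E p1)"
        by (simp add: norm_triangle_ineq)
      also have "\<dots> < e" using n1 n2 by simp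
      finally show "norm ((\<Sum>(t, K)\<in>p. measure lborel K *\<^sub>R f0 t) - (g b - g a)) < e" .
    qed
  qed
  then show ?thesis
    by (rule has_integral_spike[OF Z, rotated]) (simp add: f0_def)
qed

lemma absolutely_continuous_decrease:
  fixes g w :: "real \<Rightarrow> real"
  assumes ab: "a \<le> b" and ac: "absolutely_continuous_fun_on {a..b} g" and Z: "negligible Z"
    and der: "\<And>t. t \<in> {a..b} - Z \<Longrightarrow> \<exists>d. (g has_vector_derivative d) (at t within {a..b}) \<and> d \<le> - w t"
    and w: "w integrable_on {a..b}"
  shows "g b + integral {a..b} w \<le> g a"
proof -
  obtain f where f: "\<And>t. t \<in> {a..b} - Z \<Longrightarrow> (g has_vector_derivative f t) (at t within {a..b}) \<and> f t \<le> - w t"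
    using der by metis
  have fi: "(f has_integral (g b - g a)) {a..b}"
    by (rule fundamental_theorem_of_calculus_absolutely_continuous[OF ab ac Z]) (use f in auto)
  \<comment> \<open>Nothing is known about \<open>f\<close> on \<open>Z\<close>; overwriting it
    there by \<open>- w\<close> makes the comparison valid at every point and leaves the integral
    unchanged.\<close>
  have "((\<lambda>t. if t \<in> Z then - w t else f t) has_integral (g b - g a)) {a..b}"
    by (rule has_integral_spike[OF Z _ fi]) auto
  moreover have "((\<lambda>t. - w t) has_integral - integral {a..b} w) {a..b}"
    using w by (simp add: has_integral_neg_iff integrable_integral)
  ultimately have "g b - g a \<le> - integral {a..b} w"
    by (rule has_integral_le) (use f in auto)
  then show ?thesis by simp
qed

section \<open>Derivative of the minimum of finitely many functions\<close>

text \<open>Each point is assigned a member of a countable base that isolates it; two points cannot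
  share such a member.\<close>

lemma countable_if_isolated_points:
  fixes X :: "'a::second_countable_topology set"
  assumes "\<And>x. x \<in> X \<Longrightarrow> \<exists>U. open U \<and> x \<in> U \<and> U \<inter> X \<subseteq> {x}"
  shows "countable X"
proof -
  obtain B :: "'a set set" where B: "countable B" "topological_basis B"
    using ex_countable_basis by blast
  have "\<exists>b\<in>B. x \<in> b \<and> b \<inter> X \<subseteq> {x}" if "x \<in> X" for x
  proof -
    obtain U where "open U" "x \<in> U" "U \<inter> X \<subseteq> {x}" using assms[OF \<open>x \<in> X\<close>] by blast
    moreover obtain b where "b \<in> B" "x \<in> b" "b \<subseteq> U"
      using topological_basisE[OF B(2) calculation(1,2)] by blast
    ultimately show ?thesis by blast
  qed
  then obtain b where b: "\<And>x. x \<in> X \<Longrightarrow> b x \<in> B \<and> x \<in> b x \<and> b x \<inter> X \<subseteq> {x}"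
    by metis
  have "inj_on b X" by (intro inj_onI) (metis b IntI singletonD subsetD)
  moreover have "countable (b ` X)" using b B(1) by (auto intro: countable_subset)
  ultimately show ?thesis by (rule countable_image_inj_on[rotated])
qed

text \<open>A nonzero limit of the difference quotients keeps \<open>h\<close> away from 0 at all
  other points of \<open>S\<close> near \<open>t\<close>, so \<open>t\<close> is isolated even among
  all zeros of \<open>h\<close> in \<open>S\<close>.\<close>

lemma countable_simple_zeros:
  fixes h :: "real \<Rightarrow> real"
  shows "countable {t \<in> S. h t = 0 \<and> (\<exists>d. d \<noteq> 0 \<and> (h has_real_derivative d) (at t within S))}"
    (is "countable ?X")
proof (rule countable_if_isolated_points)
  fix t assume "t \<in> ?X"
  then obtain d where t: "t \<in> S" "h t = 0" and d: "d \<noteq> 0" "(h has_real_derivative d) (at t within S)"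
    by blast
  have "\<forall>\<^sub>F s in at t within S. (h s - h t) / (s - t) \<noteq> 0"
    using d tendsto_imp_eventually_ne unfolding has_field_derivative_iff by blast
  then have "\<forall>\<^sub>F s in at t within S. h s \<noteq> 0"
    by eventually_elim (use t in auto)
  then obtain U where "open U" "t \<in> U" "\<forall>s\<in>U. s \<noteq> t \<longrightarrow> s \<in> S \<longrightarrow> h s \<noteq> 0"
    unfolding eventually_at_topological by blast
  then show "\<exists>U. open U \<and> t \<in> U \<and> U \<inter> ?X \<subseteq> {t}"
    by (intro exI[of _ U]) auto
qed

text \<open>By continuity, only functions already minimal at \<open>t\<close> can attain the minimum
  near \<open>t\<close>. The difference quotient of the minimum is therefore always one of finitely
  many quotients tending to \<open>D\<close>, even if the minimising index keeps changing.\<close>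

lemma has_real_derivative_Min:
  fixes f :: "'i \<Rightarrow> real \<Rightarrow> real"
  assumes I: "finite I" "I \<noteq> {}"
    and f: "\<And>i. i \<in> I \<Longrightarrow> (f i has_real_derivative d i) (at t within S)"
    and D: "\<And>i. \<lbrakk>i \<in> I; f i t = Min ((\<lambda>i. f i t) ` I)\<rbrakk> \<Longrightarrow> d i = D"
  shows "((\<lambda>s. Min ((\<lambda>i. f i s) ` I)) has_real_derivative D) (at t within S)"
proof -
  define g where "g = (\<lambda>s. Min ((\<lambda>i. f i s) ` I))"
  have g_le: "g s \<le> f i s" if "i \<in> I" for i s
    using I that by (auto simp: g_def)
  have g_ex: "\<exists>i\<in>I. g s = f i s" for s
    using Min_in[of "(\<lambda>i. f i s) ` I"] I unfolding g_def by blast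
  obtain k where k: "k \<in> I" "g t = f k t" using g_ex by blast
  have lim: "((\<lambda>s. f i s) \<longlongrightarrow> f i t) (at t within S)" if "i \<in> I" for i
    using DERIV_continuous[OF f[OF that]] by (simp add: continuous_within)
  have "((\<lambda>s. (g s - g t) / (s - t)) \<longlongrightarrow> D) (at t within S)"
  proof (rule tendstoI)
    fix e :: real assume e: "0 < e"
    have "\<forall>\<^sub>F s in at t within S. (f i t = g t \<longrightarrow> dist ((f i s - g t) / (s - t)) D < e) \<and>
        (f i t \<noteq> g t \<longrightarrow> f k s < f i s)" if i: "i \<in> I" for i
    proof (cases "f i t = g t")
      case True
      then have "d i = D" using D[OF i] by (simp add: g_def)
      with f[OF i] have "((\<lambda>s. (f i s - f i t) / (s - t)) \<longlongrightarrow> D) (at t within S)"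
        by (simp add: has_field_derivative_iff)
      from tendstoD[OF this e] show ?thesis using True by simp
    next
      case False
      then have "f k t < f i t" using g_le[OF i, of t] k by simp
      then have "0 < f i t - f k t" by simp
      from order_tendstoD(1)[OF tendsto_diff[OF lim[OF i] lim[OF k(1)]] this]
      have "\<forall>\<^sub>F s in at t within S. f k s < f i s" by simp
      with False show ?thesis by simp
    qed
    then have "\<forall>\<^sub>F s in at t within S. \<forall>i\<in>I. (f i t = g t \<longrightarrow> dist ((f i s - g t) / (s - t)) D < e) \<and>
        (f i t \<noteq> g t \<longrightarrow> f k s < f i s)"
      using I(1) by (intro eventually_ball_finite) auto
    then show "\<forall>\<^sub>F s in at t within S. dist ((g s - g t) / (s - t)) D < e"
    proof eventually_elim
      case (elim s)
      obtain j where j: "j \<in> I" "g s = f j s" using g_ex by blast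
      then have "f j t = g t" using elim g_le[OF k(1), of s] by force
      with elim j show ?case by auto
    qed
  qed
  then show ?thesis by (simp add: has_field_derivative_iff g_def)
qed

text \<open>Two functions that meet at \<open>t\<close> with different slopes meet nowhere else near \<open>t\<close>; hence, off a
  countable set, all functions attaining the minimum have the same derivative.\<close>

lemma Min_derivative_off_countable:
  fixes f :: "'i \<Rightarrow> real \<Rightarrow> real"
  assumes I: "finite I"
  obtains Z where "countable Z"
    "\<And>t d k. \<lbrakk>t \<in> S - Z; \<And>i. i \<in> I \<Longrightarrow> (f i has_real_derivative d i) (at t within S);
       k \<in> I; f k t = Min ((\<lambda>i. f i t) ` I)\<rbrakk>
       \<Longrightarrow> ((\<lambda>s. Min ((\<lambda>i. f i s) ` I)) has_real_derivative d k) (at t within S)"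
proof -
  \<comment> \<open>The slope is quantified inside the set, so that the exceptional set depends on
    \<open>f\<close> and \<open>S\<close> alone; the derivatives \<open>d\<close> are supplied
    later, for one \<open>t\<close> at a time.\<close>
  define X where "X = (\<lambda>i j. {t \<in> S. f i t - f j t = 0 \<and>
      (\<exists>d. d \<noteq> 0 \<and> ((\<lambda>t. f i t - f j t) has_real_derivative d) (at t within S))})"
  define Z where "Z = (\<Union>i\<in>I. \<Union>j\<in>I. X i j)"
  have "countable (X i j)" for i j
    unfolding X_def by (rule countable_simple_zeros)
  then have "countable Z" using I by (auto simp: Z_def intro!: countable_UN intro: countable_finite)
  moreover have "((\<lambda>s. Min ((\<lambda>i. f i s) ` I)) has_real_derivative d k) (at t within S)"
    if t: "t \<in> S - Z" and d: "\<And>i. i \<in> I \<Longrightarrow> (f i has_real_derivative d i) (at t within S)"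
      and k: "k \<in> I" "f k t = Min ((\<lambda>i. f i t) ` I)" for t d k
  proof (rule has_real_derivative_Min[where d = d])
    show "d i = d k" if i: "i \<in> I" "f i t = Min ((\<lambda>i. f i t) ` I)" for i
    proof (rule ccontr)
      assume "d i \<noteq> d k"
      moreover have "((\<lambda>t. f i t - f k t) has_real_derivative d i - d k) (at t within S)"
        using d i k by (intro DERIV_diff) auto
      ultimately have "t \<in> X i k" using t i k by (auto simp: X_def intro!: exI[of _ "d i - d k"])
      then show False using t i k by (auto simp: Z_def)
    qed
  qed (use I d k in auto)
  ultimately show ?thesis using that by blast
qed

section \<open>Bounds and derivatives of quadratic forms\<close>

text \<open>By homogeneity it suffices to bound the form on the unit sphere, where compactness
  provides a positive minimum.\<close>

lemma positive_quadratic_form_lower_bound: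
  fixes M :: "real^'n^'n"
  assumes "\<And>x. x \<noteq> 0 \<Longrightarrow> 0 < x \<bullet> (M *v x)"
  shows "\<exists>c>0. \<forall>x. c * (norm x)\<^sup>2 \<le> x \<bullet> (M *v x)"
proof -
  let ?q = "\<lambda>x. x \<bullet> (M *v x)"
  have "sphere (0::real^'n) 1 \<noteq> {}" by simp
  moreover have "continuous_on (sphere 0 1) ?q"
    by (intro continuous_intros matrix_vector_mult_linear_continuous_on linear_continuous_on matrix_vector_mul_bounded_linear)
  ultimately obtain z where z: "z \<in> sphere 0 1" "\<And>y. y \<in> sphere 0 1 \<Longrightarrow> ?q z \<le> ?q y"
    using continuous_attains_inf[of "sphere (0::real^'n) 1" ?q] by auto
  have "0 < ?q z" using z(1) by (intro assms) auto
  moreover have "?q z * (norm x)\<^sup>2 \<le> ?q x" for x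
  proof (cases "x = 0")
    case False
    then have "?q z \<le> ?q (inverse (norm x) *\<^sub>R x)" by (intro z(2)) auto
    also have "\<dots> = ?q x / (norm x)\<^sup>2"
      by (simp add: matrix_vector_mult_scaleR power2_eq_square divide_inverse)
    finally show ?thesis using False by (simp add: field_simps)
  qed simp
  ultimately show ?thesis by blast
qed

lemma negative_quadratic_form_upper_bound:
  fixes M :: "real^'n^'n"
  assumes "\<And>x. x \<noteq> 0 \<Longrightarrow> x \<bullet> (M *v x) < 0"
  shows "\<exists>c>0. \<forall>x. x \<bullet> (M *v x) \<le> - c * (norm x)\<^sup>2"
proof -
  have m: "x \<bullet> ((- M) *v x) = - (x \<bullet> (M *v x))" for x
    using matrix_vector_mult_diff_rdistrib[of 0 M x] by simp
  have "\<exists>c>0. \<forall>x. c * (norm x)\<^sup>2 \<le> x \<bullet> ((- M) *v x)"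
    by (rule positive_quadratic_form_lower_bound) (use assms m in simp)
  then obtain c where "0 < c" "\<And>x. c * (norm x)\<^sup>2 \<le> - (x \<bullet> (M *v x))"
    unfolding m by blast
  then show ?thesis by (intro exI[of _ c]) (simp add: le_minus_iff)
qed

lemma bilinear_matrix_bound:
  fixes M :: "real^'n^'m"
  shows "\<bar>x \<bullet> (M *v y)\<bar> \<le> onorm ((*v) M) * norm x * norm y"
proof -
  have "\<bar>x \<bullet> (M *v y)\<bar> \<le> norm x * norm (M *v y)" by (rule Cauchy_Schwarz_ineq2)
  also have "\<dots> \<le> norm x * (onorm ((*v) M) * norm y)"
    by (intro mult_left_mono onorm) auto
  finally show ?thesis by (simp add: mult_ac)
qed

lemma quadratic_form_has_derivative:
  fixes M :: "real^'n^'n" and x :: "real \<Rightarrow> real^'n"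
  assumes "(x has_vector_derivative \<xi>) (at t within S)"
  shows "((\<lambda>s. x s \<bullet> (M *v x s)) has_real_derivative (x t \<bullet> (M *v \<xi>) + \<xi> \<bullet> (M *v x t))) (at t within S)"
proof -
  have "((\<lambda>s. M *v x s) has_vector_derivative (M *v \<xi>)) (at t within S)"
    by (rule bounded_linear.has_vector_derivative[OF matrix_vector_mul_bounded_linear assms])
  from bounded_bilinear.has_vector_derivative[OF bounded_bilinear_inner assms this]
  show ?thesis by (simp add: has_real_derivative_iff_has_vector_derivative)
qed

section \<open>Absolute continuity: restriction, continuity, composition\<close>

lemma absolutely_continuous_fun_on_subset:
  assumes "absolutely_continuous_fun_on S f" "T \<subseteq> S"
  shows "absolutely_continuous_fun_on T f"
  unfolding absolutely_continuous_fun_on_def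
proof (intro allI impI)
  fix \<epsilon> :: real assume "0 < \<epsilon>"
  with assms(1) obtain \<delta> where \<delta>: "0 < \<delta>" and *: "\<And>D. finite D \<and> (\<forall>(a, b)\<in>D. a < b \<and> {a..b} \<subseteq> S) \<and>
        disjoint_family_on (\<lambda>(a, b). {a<..<b}) D \<and> (\<Sum>(a, b)\<in>D. b - a) < \<delta>
        \<Longrightarrow> (\<Sum>(a, b)\<in>D. dist (f a) (f b)) < \<epsilon>"
    unfolding absolutely_continuous_fun_on_def by blast
  show "\<exists>\<delta>>0. \<forall>D. finite D \<and> (\<forall>(a, b)\<in>D. a < b \<and> {a..b} \<subseteq> T) \<and>
        disjoint_family_on (\<lambda>(a, b). {a<..<b}) D \<and> (\<Sum>(a, b)\<in>D. b - a) < \<delta>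
        \<longrightarrow> (\<Sum>(a, b)\<in>D. dist (f a) (f b)) < \<epsilon>"
    using assms(2) by (intro exI[of _ \<delta>] conjI \<delta> allI impI *) (auto simp: subset_iff split: prod.splits)
qed

lemma absolutely_continuous_imp_continuous_on:
  fixes f :: "real \<Rightarrow> 'a::metric_space"
  assumes "absolutely_continuous_fun_on {a..b} f"
  shows "continuous_on {a..b} f"
  unfolding continuous_on_iff
proof (intro ballI allI impI)
  fix s and \<epsilon> :: real assume s: "s \<in> {a..b}" and "0 < \<epsilon>"
  with assms obtain \<delta> where \<delta>: "0 < \<delta>" and *: "\<And>D. finite D \<and> (\<forall>(u, v)\<in>D. u < v \<and> {u..v} \<subseteq> {a..b}) \<and>
        disjoint_family_on (\<lambda>(u, v). {u<..<v}) D \<and> (\<Sum>(u, v)\<in>D. v - u) < \<delta>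
        \<Longrightarrow> (\<Sum>(u, v)\<in>D. dist (f u) (f v)) < \<epsilon>"
    unfolding absolutely_continuous_fun_on_def by blast
  have close: "dist (f u) (f v) < \<epsilon>" if "u < v" "u \<in> {a..b}" "v \<in> {a..b}" "v - u < \<delta>" for u v
    using *[of "{(u, v)}"] that by (auto simp: disjoint_family_on_def)
  have "dist (f t) (f s) < \<epsilon>" if "t \<in> {a..b}" "dist t s < \<delta>" for t
    using close[of s t] close[of t s] that s \<open>0 < \<epsilon>\<close>
    by (cases s t rule: linorder_cases) (auto simp: dist_real_def dist_commute)
  with \<delta> show "\<exists>d>0. \<forall>t\<in>{a..b}. dist t s < d \<longrightarrow> dist (f t) (f s) < \<epsilon>" by blast
qed

text \<open>The Lipschitz estimate is asked only between values of \<open>x\<close>, since quadratic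
  growth allows one only on bounded sets.\<close>

lemma absolutely_continuous_Lipschitz_compose:
  fixes x :: "real \<Rightarrow> 'a::metric_space" and V :: "'a \<Rightarrow> 'b::metric_space"
  assumes ac: "absolutely_continuous_fun_on S x"
    and lip: "\<And>s t. \<lbrakk>s \<in> S; t \<in> S\<rbrakk> \<Longrightarrow> dist (V (x s)) (V (x t)) \<le> L * dist (x s) (x t)"
  shows "absolutely_continuous_fun_on S (\<lambda>t. V (x t))"
  unfolding absolutely_continuous_fun_on_def
proof (intro allI impI)
  fix \<epsilon> :: real assume "0 < \<epsilon>"
  \<comment> \<open>\<open>L\<close> may be zero or negative, and the argument divides by the
    constant.\<close>
  define L' where "L' = \<bar>L\<bar> + 1"
  have L': "0 < L'" "L \<le> L'" by (auto simp: L'_def)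
  then have "0 < \<epsilon> / L'" using \<open>0 < \<epsilon>\<close> by simp
  with ac obtain \<delta> where \<delta>: "0 < \<delta>" and *: "\<And>D. finite D \<and> (\<forall>(a, b)\<in>D. a < b \<and> {a..b} \<subseteq> S) \<and>
        disjoint_family_on (\<lambda>(a, b). {a<..<b}) D \<and> (\<Sum>(a, b)\<in>D. b - a) < \<delta>
        \<Longrightarrow> (\<Sum>(a, b)\<in>D. dist (x a) (x b)) < \<epsilon> / L'"
    unfolding absolutely_continuous_fun_on_def by blast
  have "(\<Sum>(a, b)\<in>D. dist (V (x a)) (V (x b))) < \<epsilon>"
    if D: "finite D \<and> (\<forall>(a, b)\<in>D. a < b \<and> {a..b} \<subseteq> S) \<and>
        disjoint_family_on (\<lambda>(a, b). {a<..<b}) D \<and> (\<Sum>(a, b)\<in>D. b - a) < \<delta>" for D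
  proof -
    have "(\<Sum>(a, b)\<in>D. dist (V (x a)) (V (x b))) \<le> (\<Sum>(a, b)\<in>D. L' * dist (x a) (x b))"
    proof (rule sum_mono, clarify)
      fix a b assume "(a, b) \<in> D"
      then have "a < b" "{a..b} \<subseteq> S" using D by auto
      then have "a \<in> S" "b \<in> S" by auto
      from lip[OF this] show "dist (V (x a)) (V (x b)) \<le> L' * dist (x a) (x b)"
        using L'(2) by (meson mult_right_mono order_trans zero_le_dist)
    qed
    also have "\<dots> = L' * (\<Sum>(a, b)\<in>D. dist (x a) (x b))"
      by (simp add: sum_distrib_left case_prod_unfold)
    also have "\<dots> < \<epsilon>" using *[OF D] L'(1) by (simp add: field_simps)
    finally show ?thesis .
  qed
  with \<delta> show "\<exists>\<delta>>0. \<forall>D. finite D \<and> (\<forall>(a, b)\<in>D. a < b \<and> {a..b} \<subseteq> S) \<and>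
        disjoint_family_on (\<lambda>(a, b). {a<..<b}) D \<and> (\<Sum>(a, b)\<in>D. b - a) < \<delta>
        \<longrightarrow> (\<Sum>(a, b)\<in>D. dist (V (x a)) (V (x b))) < \<epsilon>"
    by blast
qed

section \<open>The Lyapunov function and the modes attaining it\<close>

text \<open>Its value at \<open>x 0\<close> is the right-hand side of the cost bound.\<close>

definition min_form :: "nat \<Rightarrow> (nat \<Rightarrow> real^'n^'n) \<Rightarrow> real^'n \<Rightarrow> real" where
  "min_form N P y = Min ((\<lambda>i. y \<bullet> (P i *v y)) ` {1..N})"

lemma min_form_le: "i \<in> {1..N} \<Longrightarrow> min_form N P y \<le> y \<bullet> (P i *v y)"
  by (auto simp: min_form_def)

lemma switching_law_attains:
  assumes "1 \<le> N"
  shows "switching_law N P y \<in> {1..N}"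
    and "y \<bullet> (P (switching_law N P y) *v y) = min_form N P y"
proof -
  let ?v = "\<lambda>i. y \<bullet> (P i *v y)"
  let ?M = "{i. is_arg_min ?v (\<lambda>i. i \<in> {1..N}) i}"
  have M: "?M = {i \<in> {1..N}. ?v i = min_form N P y}"
  proof safe
    fix i assume i: "is_arg_min ?v (\<lambda>i. i \<in> {1..N}) i"
    then show "i \<in> {1..N}" by (simp add: is_arg_min_def)
    show "?v i = min_form N P y"
      unfolding min_form_def
      by (rule Min_eqI[symmetric]) (use i in \<open>auto simp: is_arg_min_linorder\<close>)
  next
    fix i assume "i \<in> {1..N}" "?v i = min_form N P y"
    then show "is_arg_min ?v (\<lambda>i. i \<in> {1..N}) i"
      using min_form_le[of _ N P y] by (auto simp: is_arg_min_linorder)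
  qed
  have "min_form N P y \<in> ?v ` {1..N}"
    unfolding min_form_def using assms by (intro Min_in) auto
  then have "?M \<noteq> {}" unfolding M by auto
  moreover have "finite ?M" unfolding M by simp
  ultimately have "switching_law N P y \<in> ?M"
    unfolding switching_law_def by (rule Min_in[rotated])
  then show "switching_law N P y \<in> {1..N}" "?v (switching_law N P y) = min_form N P y"
    unfolding M by auto
qed

text \<open>The closure makes two arguments available: a closed condition holding where mode
  \<open>i\<close> is selected passes to all states where \<open>i\<close> is active, and the times
  at which \<open>i\<close> is active along a continuous trajectory form a closed set.\<close>

lemma active_modes_closure:
  "active_modes N \<sigma> y = {i\<in>{1..N}. y \<in> closure {z. \<sigma> z = i}}"
proof -
  have "(\<forall>U. open U \<and> y \<in> U \<longrightarrow> U \<inter> X \<noteq> {}) \<longleftrightarrow> y \<in> closure X" for X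
  proof
    assume *: "\<forall>U. open U \<and> y \<in> U \<longrightarrow> U \<inter> X \<noteq> {}"
    show "y \<in> closure X"
      using *[rule_format, of "- closure X"] closure_subset[of X] by auto
  next
    assume "y \<in> closure X"
    then show "\<forall>U. open U \<and> y \<in> U \<longrightarrow> U \<inter> X \<noteq> {}"
      using open_Int_closure_eq_empty by blast
  qed
  then show ?thesis by (simp add: active_modes_def)
qed

lemma finite_active_modes [simp]: "finite (active_modes N \<sigma> y)"
  by (simp add: active_modes_def)

lemma switching_law_active:
  assumes "1 \<le> N"
  shows "switching_law N P y \<in> active_modes N (switching_law N P) y"
  using switching_law_attains(1)[OF assms, where P = P and y = y] closure_subset[of "{z. switching_law N P z = switching_law N P y}"]
  by (auto simp: active_modes_closure)

lemma continuous_on_quadratic_form [continuous_intros]: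
  fixes M :: "real^'n^'n"
  assumes "continuous_on S x"
  shows "continuous_on S (\<lambda>t. x t \<bullet> (M *v x t))"
  by (intro continuous_intros assms bounded_linear.continuous_on[OF matrix_vector_mul_bounded_linear])

text \<open>The set where form \<open>i\<close> is minimal is closed and contains the region in
  which the law selects \<open>i\<close>, hence also the closure of that region. An active mode can
  thus differ from the selected one only at a tie.\<close>

lemma active_mode_attains:
  assumes "1 \<le> N" and i: "i \<in> active_modes N (switching_law N P) y"
  shows "y \<bullet> (P i *v y) = min_form N P y"
proof -
  let ?C = "{z. \<forall>j\<in>{1..N}. z \<bullet> (P i *v z) \<le> z \<bullet> (P j *v z)}"
  have "closed ?C"
    unfolding Ball_def by (intro closed_Collect_all closed_Collect_imp closed_Collect_le continuous_intros) auto
  moreover have "{z. switching_law N P z = i} \<subseteq> ?C"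
    using switching_law_attains(2)[OF assms(1), where P = P] min_form_le[of _ N P] by auto
  ultimately have "closure {z. switching_law N P z = i} \<subseteq> ?C" by (rule closure_minimal[rotated])
  then have "y \<in> ?C" "i \<in> {1..N}" using i by (auto simp: active_modes_closure)
  then show ?thesis
    using min_form_le[of i N P y] switching_law_attains[OF assms(1), where P = P and y = y] by fastforce
qed

lemma quadratic_form_sum:
  fixes M :: "'i \<Rightarrow> real^'n^'n"
  assumes "finite J"
  shows "y \<bullet> ((\<Sum>j\<in>J. a j *\<^sub>R M j) *v y) = (\<Sum>j\<in>J. a j * (y \<bullet> (M j *v y)))"
  using assms by (induction J rule: finite_induct)
    (simp_all add: matrix_vector_mult_add_rdistrib scaleR_matrix_vector_assoc[symmetric] inner_add_right)

section \<open>Dissipation inequalities for single modes and for velocities\<close>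

text \<open>Evaluated at \<open>y\<close>, the first two matrix terms become \<open>vdot\<close>,
  and the coupling sum stands on the side where it can be discarded once it is known to be
  nonnegative.\<close>

lemma lyapunov_mode_inequality:
  fixes A P Q :: "nat \<Rightarrow> real^'n^'n"
  assumes N: "1 \<le> N" and \<pi>: "\<pi> \<in> Metzler_zero_colsum N"
    and c: "\<And>z. z \<bullet> ((transpose (A i) ** P i + P i ** A i + (\<Sum>j=1..N. \<pi> j i *\<^sub>R P j) + Q i) *v z) \<le> - c * (norm z)\<^sup>2"
    and i: "i \<in> active_modes N (switching_law N P) y"
  shows "vdot P i y (A i *v y) \<le> - c * (norm y)\<^sup>2 - y \<bullet> (Q i *v y)"
proof -
  have iN: "i \<in> {1..N}" using i by (simp add: active_modes_def)
  \<comment> \<open>Column sums vanish, so the minimum may be subtracted from every form; then the diagonal term,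
    the only one with a weight of unknown sign, is zero because mode \<open>i\<close> attains the minimum.\<close>
  have "0 \<le> (\<Sum>j=1..N. \<pi> j i * (y \<bullet> (P j *v y) - min_form N P y))"
  proof (rule sum_nonneg)
    fix j assume j: "j \<in> {1..N}"
    show "0 \<le> \<pi> j i * (y \<bullet> (P j *v y) - min_form N P y)"
    proof (cases "j = i")
      case True
      then show ?thesis using active_mode_attains[OF N i] by simp
    next
      case False
      then show ?thesis
        using \<pi> j iN min_form_le[OF j, of P y] by (auto simp: Metzler_zero_colsum_def)
    qed
  qed
  also have "\<dots> = (\<Sum>j=1..N. \<pi> j i * (y \<bullet> (P j *v y))) - (\<Sum>j=1..N. \<pi> j i) * min_form N P y"
    by (simp add: right_diff_distrib sum_subtractf sum_distrib_right)
  also have "(\<Sum>j=1..N. \<pi> j i) = 0" using \<pi> iN by (simp add: Metzler_zero_colsum_def)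
  finally have pos: "0 \<le> (\<Sum>j=1..N. \<pi> j i * (y \<bullet> (P j *v y)))" by simp
  have sum: "y \<bullet> ((\<Sum>j=1..N. \<pi> j i *\<^sub>R P j) *v y) = (\<Sum>j=1..N. \<pi> j i * (y \<bullet> (P j *v y)))"
    by (rule quadratic_form_sum) simp
  have tr: "y \<bullet> ((transpose (A i) ** P i) *v y) = (A i *v y) \<bullet> (P i *v y)"
    by (metis dot_lmul_matrix inner_commute matrix_vector_mul_assoc transpose_matrix_vector)
  show ?thesis
    using c[of y] pos unfolding sum[symmetric]
    by (simp add: vdot_def matrix_vector_mult_add_rdistrib inner_add_right tr matrix_vector_mul_assoc)
qed

text \<open>The condition on the weights passes from the selected form along the whole velocity to
  each active form along its own field, where the mode inequality applies. As every representation
  \<open>a\<close> is covered, the same \<open>c\<close> serves both the weights hidden in the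
  solution concept and the prescribed ones in the cost.\<close>

lemma lyapunov_velocity_inequality:
  fixes A P Q :: "nat \<Rightarrow> real^'n^'n"
  assumes N: "1 \<le> N" and \<pi>: "\<pi> \<in> Metzler_zero_colsum N"
    and neg: "\<forall>i\<in>{1..N}. neg_def (transpose (A i) ** P i + P i ** A i + (\<Sum>j=1..N. \<pi> j i *\<^sub>R P j) + Q i)"
  obtains c where "0 < c" and "\<And>y \<xi> a. represents_velocity N A P (switching_law N P) y \<xi> a \<Longrightarrow>
      vdot P (switching_law N P y) y \<xi> \<le>
      - (c * (norm y)\<^sup>2 + (\<Sum>i\<in>active_modes N (switching_law N P) y. a i * (y \<bullet> (Q i *v y))))"
proof -
  let ?M = "\<lambda>i. transpose (A i) ** P i + P i ** A i + (\<Sum>j=1..N. \<pi> j i *\<^sub>R P j) + Q i"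
  let ?I = "active_modes N (switching_law N P)"
  have "\<forall>i\<in>{1..N}. \<exists>c>0. \<forall>z. z \<bullet> (?M i *v z) \<le> - c * (norm z)\<^sup>2"
    by (rule ballI, rule negative_quadratic_form_upper_bound) (use neg in \<open>simp add: neg_def_def\<close>)
  from bchoice[OF this] obtain c where c: "\<And>i. i \<in> {1..N} \<Longrightarrow> 0 < c i"
    "\<And>i z. i \<in> {1..N} \<Longrightarrow> z \<bullet> (?M i *v z) \<le> - c i * (norm z)\<^sup>2"
    by blast
  define c0 where "c0 = Min (c ` {1..N})"
  have c0: "0 < c0" using c(1) N by (simp add: c0_def)
  have c0_le: "c0 \<le> c i" if "i \<in> {1..N}" for i using that by (simp add: c0_def)
  have "vdot P (switching_law N P y) y \<xi> \<le>
      - (c0 * (norm y)\<^sup>2 + (\<Sum>i\<in>?I y. a i * (y \<bullet> (Q i *v y))))"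
    if rep: "represents_velocity N A P (switching_law N P) y \<xi> a" for y \<xi> a
  proof -
    have a: "\<And>i. i \<in> ?I y \<Longrightarrow> 0 \<le> a i" "(\<Sum>i\<in>?I y. a i) = 1"
      using rep by (auto simp: represents_velocity_def)
    have "vdot P (switching_law N P y) y \<xi> \<le> (\<Sum>i\<in>?I y. vdot P i y (a i *\<^sub>R (A i *v y)))"
      using rep by (simp add: represents_velocity_def)
    also have "\<dots> = (\<Sum>i\<in>?I y. a i * vdot P i y (A i *v y))"
      by (simp add: vdot_def matrix_vector_mult_scaleR algebra_simps)
    also have "\<dots> \<le> (\<Sum>i\<in>?I y. a i * (- c0 * (norm y)\<^sup>2 - y \<bullet> (Q i *v y)))"
    proof (rule sum_mono, rule mult_left_mono)
      fix i assume i: "i \<in> ?I y"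
      then have iN: "i \<in> {1..N}" by (simp add: active_modes_def)
      have "vdot P i y (A i *v y) \<le> - c i * (norm y)\<^sup>2 - y \<bullet> (Q i *v y)"
        using lyapunov_mode_inequality[where A = A and P = P and Q = Q and \<pi> = \<pi> and N = N and c = "c i" and i = i, OF N \<pi> c(2)[OF iN] i] .
      also have "\<dots> \<le> - c0 * (norm y)\<^sup>2 - y \<bullet> (Q i *v y)"
        using c0_le[OF iN] by (simp add: mult_right_mono)
      finally show "vdot P i y (A i *v y) \<le> - c0 * (norm y)\<^sup>2 - y \<bullet> (Q i *v y)" .
    qed (use a in auto)
    also have "\<dots> = - ((\<Sum>i\<in>?I y. a i) * (c0 * (norm y)\<^sup>2) + (\<Sum>i\<in>?I y. a i * (y \<bullet> (Q i *v y))))"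
      by (simp add: right_diff_distrib sum_subtractf sum_distrib_right sum_negf)
    finally show ?thesis using a(2) by simp
  qed
  with c0 that show ?thesis by blast
qed

section \<open>Local Lipschitz continuity and quadratic bounds of the Lyapunov function\<close>

text \<open>The index minimal at \<open>z\<close> is a competitor at \<open>y\<close>, so the
  increment of the minimum is at most the increment of that single form; exchanging \<open>y\<close>
  and \<open>z\<close> gives the other sign.\<close>

lemma min_form_Lipschitz:
  fixes P :: "nat \<Rightarrow> real^'n^'n"
  assumes N: "1 \<le> N"
  obtains L where "\<And>y z. \<lbrakk>norm y \<le> R; norm z \<le> R\<rbrakk> \<Longrightarrow> dist (min_form N P y) (min_form N P z) \<le> L * dist y z"
proof -
  define K where "K = Max ((\<lambda>i. onorm ((*v) (P i))) ` {1..N})"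
  have K: "onorm ((*v) (P i)) \<le> K" if "i \<in> {1..N}" for i using that by (simp add: K_def)
  have le: "min_form N P y - min_form N P z \<le> (2 * K * R) * dist y z"
    if yz: "norm y \<le> R" "norm z \<le> R" for y z
  proof -
    define i where "i = switching_law N P z"
    have i: "i \<in> {1..N}" "z \<bullet> (P i *v z) = min_form N P z"
      using switching_law_attains[OF N] by (auto simp: i_def)
    have K0: "0 \<le> onorm ((*v) (P i))" "0 \<le> K"
      using onorm_pos_le[of "(*v) (P i)"] K[OF i(1)] by auto
    have b: "\<bar>u \<bullet> (P i *v v)\<bar> \<le> K * norm u * norm v" for u v
    proof -
      have "\<bar>u \<bullet> (P i *v v)\<bar> \<le> onorm ((*v) (P i)) * norm u * norm v" by (rule bilinear_matrix_bound)
      also have "\<dots> \<le> K * norm u * norm v" using K[OF i(1)] by (intro mult_right_mono) auto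
      finally show ?thesis .
    qed
    have "min_form N P y - min_form N P z \<le> y \<bullet> (P i *v y) - z \<bullet> (P i *v z)"
      using min_form_le[OF i(1), of P y] i(2) by simp
    \<comment> \<open>Each of the two terms has one factor \<open>y - z\<close> and one of norm at
      most \<open>R\<close>, which explains the constant \<open>2 * K * R\<close>.\<close>
    also have "\<dots> = (y - z) \<bullet> (P i *v y) + z \<bullet> (P i *v (y - z))"
      by (simp add: inner_diff_left inner_diff_right matrix_vector_mult_diff_distrib)
    also have "\<dots> \<le> K * norm (y - z) * norm y + K * norm z * norm (y - z)"
      using b[of "y - z" y] b[of z "y - z"] by linarith
    also have "\<dots> \<le> K * norm (y - z) * R + K * R * norm (y - z)"
      using yz K0 by (intro add_mono mult_left_mono mult_right_mono) auto
    finally show ?thesis by (simp add: dist_norm algebra_simps)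
  qed
  have "dist (min_form N P y) (min_form N P z) \<le> (2 * K * R) * dist y z"
    if "norm y \<le> R" "norm z \<le> R" for y z
    using le[OF that] le[OF that(2,1)] by (simp add: dist_real_def abs_le_iff dist_commute)
  then show ?thesis by (rule that)
qed

lemma min_form_bounds:
  fixes P :: "nat \<Rightarrow> real^'n^'n"
  assumes N: "1 \<le> N" and P: "\<forall>i\<in>{1..N}. pos_def (P i)"
  obtains l L where "0 < l" "0 < L" "\<And>y. l * (norm y)\<^sup>2 \<le> min_form N P y" "\<And>y. min_form N P y \<le> L * (norm y)\<^sup>2"
proof -
  have "\<exists>c>0. \<forall>y. c * (norm y)\<^sup>2 \<le> y \<bullet> (P i *v y)" if i: "i \<in> {1..N}" for i
    by (rule positive_quadratic_form_lower_bound) (use P i in \<open>simp add: pos_def_def\<close>)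
  then obtain c where c: "\<And>i. i \<in> {1..N} \<Longrightarrow> 0 < c i"
    "\<And>i y. i \<in> {1..N} \<Longrightarrow> c i * (norm y)\<^sup>2 \<le> y \<bullet> (P i *v y)"
    by metis
  define l where "l = Min (c ` {1..N})"
  \<comment> \<open>Any one form bounds the minimum from above; index 1 exists because
    \<open>1 \<le> N\<close>, and the summand 1 makes \<open>L\<close> positive.\<close>
  define L where "L = onorm ((*v) (P 1)) + 1"
  have "0 < l" using c(1) N by (simp add: l_def)
  moreover have "0 < L" using onorm_pos_le[of "(*v) (P 1)"] by (auto simp: L_def)
  moreover have "l * (norm y)\<^sup>2 \<le> min_form N P y" for y
  proof -
    note s = switching_law_attains[OF N, where P = P and y = y]
    have "l * (norm y)\<^sup>2 \<le> c (switching_law N P y) * (norm y)\<^sup>2"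
      using s(1) by (intro mult_right_mono) (auto simp: l_def)
    also have "\<dots> \<le> min_form N P y" using c(2)[OF s(1), of y] s(2) by simp
    finally show ?thesis .
  qed
  moreover have "min_form N P y \<le> L * (norm y)\<^sup>2" for y
  proof -
    have "min_form N P y \<le> y \<bullet> (P 1 *v y)" using N by (intro min_form_le) simp
    also have "\<dots> \<le> onorm ((*v) (P 1)) * norm y * norm y"
      using bilinear_matrix_bound[of y "P 1" y] by linarith
    also have "\<dots> \<le> L * (norm y)\<^sup>2" by (simp add: L_def power2_eq_square algebra_simps)
    finally show ?thesis .
  qed
  ultimately show ?thesis using that by blast
qed

section \<open>Integration along solutions\<close>

lemma AE_lebesgue_negligible:
  assumes "AE t in lebesgue. R t"
  obtains Z where "negligible Z" "\<And>t. t \<notin> Z \<Longrightarrow> R t"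
proof -
  obtain Z where "Z \<in> null_sets lebesgue" "{t \<in> space lebesgue. \<not> R t} \<subseteq> Z"
    using assms unfolding eventually_ae_filter by blast
  then show ?thesis by (intro that[of Z]) (auto simp: negligible_iff_null_sets)
qed

text \<open>The rate \<open>w\<close> is left open because it is used twice: with
  \<open>c |x|^2\<close> for stability, and with the running cost added for the integral
  bound.\<close>

lemma min_form_decrease:
  fixes A P :: "nat \<Rightarrow> real^'n^'n"
  assumes N: "1 \<le> N" and x: "closed_loop_solution N A P (switching_law N P) x"
    and ab: "0 \<le> a" "a \<le> b" and w: "w integrable_on {a..b}"
    and ae: "AE t in lebesgue. 0 \<le> t \<longrightarrow> (\<exists>\<xi>. (x has_vector_derivative \<xi>) (at t within {0..}) \<and>
      vdot P (switching_law N P (x t)) (x t) \<xi> \<le> - w t)"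
  shows "min_form N P (x b) + integral {a..b} w \<le> min_form N P (x a)"
proof -
  \<comment> \<open>Solutions are absolutely continuous on \<open>{0..T}\<close> for
    \<open>T > 0\<close>, while \<open>b\<close> may be 0.\<close>
  have "absolutely_continuous_fun_on {0..b + 1} x"
    using x ab by (simp add: closed_loop_solution_def)
  then have ac: "absolutely_continuous_fun_on {a..b} x"
    by (rule absolutely_continuous_fun_on_subset) (use ab in auto)
  then have "compact (x ` {a..b})"
    by (intro compact_continuous_image absolutely_continuous_imp_continuous_on) auto
  then obtain R where R: "\<And>t. t \<in> {a..b} \<Longrightarrow> norm (x t) \<le> R"
    using compact_imp_bounded bounded_iff by (metis image_eqI)
  obtain L where L: "\<And>y z. \<lbrakk>norm y \<le> R; norm z \<le> R\<rbrakk> \<Longrightarrow>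
      dist (min_form N P y) (min_form N P z) \<le> L * dist y z"
    using min_form_Lipschitz[OF N] by blast
  have acV: "absolutely_continuous_fun_on {a..b} (\<lambda>t. min_form N P (x t))"
    using ac by (rule absolutely_continuous_Lipschitz_compose) (use L R in blast)
  obtain Z1 where Z1: "negligible Z1" "\<And>t. t \<notin> Z1 \<Longrightarrow> 0 \<le> t \<longrightarrow>
      (\<exists>\<xi>. (x has_vector_derivative \<xi>) (at t within {0..}) \<and> vdot P (switching_law N P (x t)) (x t) \<xi> \<le> - w t)"
    by (rule AE_lebesgue_negligible[OF ae]) blast
  obtain Z2 where Z2: "countable Z2"
    "\<And>t d k. \<lbrakk>t \<in> {a..b} - Z2; \<And>i. i \<in> {1..N} \<Longrightarrow> ((\<lambda>s. x s \<bullet> (P i *v x s)) has_real_derivative d i) (at t within {a..b});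
       k \<in> {1..N}; x t \<bullet> (P k *v x t) = Min ((\<lambda>i. x t \<bullet> (P i *v x t)) ` {1..N})\<rbrakk>
       \<Longrightarrow> ((\<lambda>s. Min ((\<lambda>i. x s \<bullet> (P i *v x s)) ` {1..N})) has_real_derivative d k) (at t within {a..b})"
    by (rule Min_derivative_off_countable[of "{1..N}" "{a..b}" "\<lambda>i s. x s \<bullet> (P i *v x s)"]) auto
  show ?thesis
  proof (rule absolutely_continuous_decrease[where g = "\<lambda>t. min_form N P (x t)", OF ab(2) acV _ _ w])
    show "negligible (Z1 \<union> Z2)" using Z1(1) countable_imp_null_set_lborel[OF Z2(1)]
      by (simp add: negligible_iff_null_sets null_sets.Un null_sets_completionI)
    fix t assume t: "t \<in> {a..b} - (Z1 \<union> Z2)"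
    let ?\<sigma> = "switching_law N P (x t)"
    obtain \<xi> where \<xi>: "(x has_vector_derivative \<xi>) (at t within {0..})" "vdot P ?\<sigma> (x t) \<xi> \<le> - w t"
      using Z1(2)[of t] t ab by auto
    have x': "(x has_vector_derivative \<xi>) (at t within {a..b})"
      by (rule has_vector_derivative_within_subset[OF \<xi>(1)]) (use ab in auto)
    \<comment> \<open>\<open>Z2\<close> was fixed before any velocity was named, so the slopes
      \<open>d\<close> may be those of the present \<open>\<xi>\<close>; the selected mode attains
      the minimum and so determines the derivative.\<close>
    have "((\<lambda>s. Min ((\<lambda>i. x s \<bullet> (P i *v x s)) ` {1..N})) has_real_derivative vdot P ?\<sigma> (x t) \<xi>) (at t within {a..b})"
    proof (rule Z2(2)[where d = "\<lambda>i. vdot P i (x t) \<xi>"])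
      show "((\<lambda>s. x s \<bullet> (P i *v x s)) has_real_derivative vdot P i (x t) \<xi>) (at t within {a..b})" for i
        unfolding vdot_def by (rule quadratic_form_has_derivative[OF x'])
    qed (use t switching_law_attains[OF N] in \<open>auto simp: min_form_def\<close>)
    then show "\<exists>d. ((\<lambda>t. min_form N P (x t)) has_vector_derivative d) (at t within {a..b}) \<and> d \<le> - w t"
      using \<xi>(2) by (auto simp: min_form_def has_real_derivative_iff_has_vector_derivative)
  qed
qed

section \<open>Global asymptotic stability\<close>

lemma closed_loop_solution_continuous:
  assumes "closed_loop_solution N A P \<sigma> x"
  shows "continuous_on {0..} x"
  unfolding continuous_on_eq_continuous_within
proof
  fix t :: real assume t: "t \<in> {0..}"
  \<comment> \<open>The extra unit leaves room to the right of \<open>t\<close>, so that continuity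
    within the interval is continuity within the half line.\<close>
  then have "absolutely_continuous_fun_on {0..t + 1} x"
    using assms by (simp add: closed_loop_solution_def)
  then have "continuous (at t within {0..t + 1}) x"
    using absolutely_continuous_imp_continuous_on t
    by (fastforce simp: continuous_on_eq_continuous_within)
  moreover have "at t within {0..t + 1} = at t within {0..}"
    by (rule at_within_nhd[of t "{..<t + 1}"]) auto
  ultimately show "continuous (at t within {0..}) x" by simp
qed

text \<open>All fields vanish at the origin, so putting the whole weight on the selected mode, which
  is active, represents the velocity 0.\<close>

lemma closed_loop_solution_zero:
  assumes N: "1 \<le> N"
  shows "closed_loop_solution N A P (switching_law N P) (\<lambda>_. 0)"
proof -
  have "represents_velocity N A P (switching_law N P) 0 0 (\<lambda>i. if i = switching_law N P 0 then 1 else 0)"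
    using switching_law_active[OF N, of P 0] by (simp add: represents_velocity_def vdot_def)
  then have "\<exists>\<xi> a. ((\<lambda>_. 0) has_vector_derivative \<xi>) (at t within {0..}) \<and>
      represents_velocity N A P (switching_law N P) 0 \<xi> a" for t :: real
    using has_vector_derivative_const by blast
  then show ?thesis
    by (auto simp: closed_loop_solution_def absolutely_continuous_fun_on_def case_prod_unfold intro: exI[of _ 1])
qed

text \<open>Dropping the nonnegative contribution of \<open>Q\<close> leaves a continuous rate,
  which is integrable whatever weights the solution concept supplies.\<close>

lemma closed_loop_decay:
  fixes A P Q :: "nat \<Rightarrow> real^'n^'n"
  assumes N: "1 \<le> N" and Q: "\<forall>i\<in>{1..N}. pos_semidef (Q i)"
    and vel: "\<And>y \<xi> a. represents_velocity N A P (switching_law N P) y \<xi> a \<Longrightarrow>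
      vdot P (switching_law N P y) y \<xi> \<le>
      - (c * (norm y)\<^sup>2 + (\<Sum>i\<in>active_modes N (switching_law N P) y. a i * (y \<bullet> (Q i *v y))))"
    and x: "closed_loop_solution N A P (switching_law N P) x"
    and ab: "0 \<le> a" "a \<le> b"
  shows "min_form N P (x b) + integral {a..b} (\<lambda>t. c * (norm (x t))\<^sup>2) \<le> min_form N P (x a)"
proof (rule min_form_decrease[OF N x ab])
  have "continuous_on {a..b} x"
    by (rule continuous_on_subset[OF closed_loop_solution_continuous[OF x]]) (use ab in auto)
  then show "(\<lambda>t. c * (norm (x t))\<^sup>2) integrable_on {a..b}"
    by (intro integrable_continuous_real continuous_intros)
  have le: "vdot P (switching_law N P y) y \<xi> \<le> - (c * (norm y)\<^sup>2)"
    if rep: "represents_velocity N A P (switching_law N P) y \<xi> \<alpha>" for y \<xi> \<alpha>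
  proof -
    have "0 \<le> (\<Sum>i\<in>active_modes N (switching_law N P) y. \<alpha> i * (y \<bullet> (Q i *v y)))"
      using rep Q by (intro sum_nonneg mult_nonneg_nonneg)
        (auto simp: represents_velocity_def pos_semidef_def active_modes_def)
    then show ?thesis using vel[OF rep] by linarith
  qed
  have "AE t in lebesgue. 0 \<le> t \<longrightarrow> (\<exists>\<xi> a. (x has_vector_derivative \<xi>) (at t within {0..}) \<and>
      represents_velocity N A P (switching_law N P) (x t) \<xi> a)"
    using x by (simp add: closed_loop_solution_def)
  then show "AE t in lebesgue. 0 \<le> t \<longrightarrow> (\<exists>\<xi>. (x has_vector_derivative \<xi>) (at t within {0..}) \<and>
      vdot P (switching_law N P (x t)) (x t) \<xi> \<le> - (c * (norm (x t))\<^sup>2))"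
    by eventually_elim (use le in blast)
qed

lemma closed_loop_globally_asymptotically_stable:
  fixes A P :: "nat \<Rightarrow> real^'n^'n"
  assumes N: "1 \<le> N" and P: "\<forall>i\<in>{1..N}. pos_def (P i)" and c: "0 < c"
    and decay: "\<And>x a b. \<lbrakk>closed_loop_solution N A P (switching_law N P) x; 0 \<le> a; a \<le> b\<rbrakk> \<Longrightarrow>
      min_form N P (x b) + integral {a..b} (\<lambda>t. c * (norm (x t))\<^sup>2) \<le> min_form N P (x a)"
  shows "globally_asymptotically_stable (closed_loop_solution N A P (switching_law N P)) 0"
proof -
  let ?S = "closed_loop_solution N A P (switching_law N P)"
  let ?V = "min_form N P"
  obtain l L where "0 < l" "0 < L" and l2: "\<And>y. l * (norm y)\<^sup>2 \<le> ?V y" and L2: "\<And>y. ?V y \<le> L * (norm y)\<^sup>2"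
    by (rule min_form_bounds[OF N P], rule that)
  note l = \<open>0 < l\<close> l2 and L = \<open>0 < L\<close> L2
  have mono: "?V (x b) \<le> ?V (x a)" if x: "?S x" and ab: "0 \<le> a" "a \<le> b" for x a b
  proof -
    have "continuous_on {a..b} x"
      by (rule continuous_on_subset[OF closed_loop_solution_continuous[OF x]]) (use ab in auto)
    then have "0 \<le> integral {a..b} (\<lambda>t. c * (norm (x t))\<^sup>2)"
      by (intro Henstock_Kurzweil_Integration.integral_nonneg integrable_continuous_real continuous_intros)
        (use c in auto)
    then show ?thesis using decay[OF x ab] by linarith
  qed
  have stable: "\<exists>\<delta>>0. \<forall>x. ?S x \<and> dist (x 0) 0 < \<delta> \<longrightarrow> (\<forall>t\<ge>0. dist (x t) 0 < \<epsilon>)" if \<epsilon>: "0 < \<epsilon>" for \<epsilon>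
  proof (intro exI conjI allI impI)
    \<comment> \<open>The radius \<open>\<delta>\<close> is chosen such that
      \<open>L * \<delta>^2 = l * \<epsilon>^2\<close>: the ball of radius \<open>\<delta>\<close>
      then lies in a sublevel set contained in the ball of radius \<open>\<epsilon>\<close>.\<close>
    show "0 < \<epsilon> * sqrt (l / L)" using \<epsilon> l L by simp
    fix x and t :: real assume x: "?S x \<and> dist (x 0) 0 < \<epsilon> * sqrt (l / L)" and t: "0 \<le> t"
    then have "(norm (x 0))\<^sup>2 < (\<epsilon> * sqrt (l / L))\<^sup>2" by (intro power_strict_mono) auto
    then have x0: "L * (norm (x 0))\<^sup>2 < l * \<epsilon>\<^sup>2"
      using l L by (simp add: power_mult_distrib field_simps)
    have "l * (norm (x t))\<^sup>2 \<le> L * (norm (x 0))\<^sup>2"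
      using l(2)[of "x t"] mono[of x 0 t] L(2)[of "x 0"] x t by simp
    with x0 have "l * (norm (x t))\<^sup>2 < l * \<epsilon>\<^sup>2" by simp
    then have "(norm (x t))\<^sup>2 < \<epsilon>\<^sup>2" using l(1) by simp
    then show "dist (x t) 0 < \<epsilon>" using \<epsilon> by (simp add: power2_less_imp_less)
  qed
  have conv: "(x \<longlongrightarrow> 0) at_top" if x: "?S x" for x
  proof -
    \<comment> \<open>Since \<open>?V y\<close> is at most \<open>L |y|^2\<close>, this is the
      factor with \<open>k * ?V y\<close> at most \<open>c |y|^2\<close>; it turns the integrated
      rate into a multiple of \<open>?V\<close>.\<close>
    define k where "k = c / L"
    have k: "0 < k" using c L by (simp add: k_def)
    have bound: "(norm (x T))\<^sup>2 \<le> ?V (x 0) / (l * (1 + k * T))" if T: "0 \<le> T" for T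
    proof -
      have cont: "continuous_on {0..T} x"
        using closed_loop_solution_continuous[OF x] by (rule continuous_on_subset) auto
      have "k * ?V (x T) \<le> c * (norm (x t))\<^sup>2" if "t \<in> {0..T}" for t
      proof -
        have "k * ?V (x T) \<le> k * (L * (norm (x t))\<^sup>2)"
          using mono[OF x, of t T] L(2)[of "x t"] that k by (intro mult_left_mono) auto
        then show ?thesis using L(1) by (simp add: k_def)
      qed
      then have "integral {0..T} (\<lambda>t. k * ?V (x T)) \<le> integral {0..T} (\<lambda>t. c * (norm (x t))\<^sup>2)"
        by (intro integral_le integrable_continuous_real continuous_intros cont) auto
      then have "?V (x T) + T * (k * ?V (x T)) \<le> ?V (x 0)"
        using decay[OF x, of 0 T] T by (simp add: algebra_simps)
      then have "?V (x T) * (1 + k * T) \<le> ?V (x 0)" by (simp add: algebra_simps)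
      moreover have "l * (norm (x T))\<^sup>2 * (1 + k * T) \<le> ?V (x T) * (1 + k * T)"
        using l(2) k T by (intro mult_right_mono) auto
      ultimately have "l * (norm (x T))\<^sup>2 * (1 + k * T) \<le> ?V (x 0)" by linarith
      moreover have "0 < 1 + k * T" using k T by (simp add: add_pos_nonneg)
      ultimately show ?thesis
        using l(1) by (subst pos_le_divide_eq) (simp_all only: mult_pos_pos mult_ac)
    qed
    have "filterlim (\<lambda>T. 1 + k * T) at_top at_top"
      using k by (intro filterlim_tendsto_add_at_top[OF tendsto_const]
          filterlim_tendsto_pos_mult_at_top[OF tendsto_const] filterlim_ident)
    then have "filterlim (\<lambda>T. l * (1 + k * T)) at_top at_top"
      using l(1) by (intro filterlim_tendsto_pos_mult_at_top[OF tendsto_const])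
    then have lim: "((\<lambda>T. ?V (x 0) / (l * (1 + k * T))) \<longlongrightarrow> 0) at_top"
      by (intro real_tendsto_divide_at_top[OF tendsto_const])
    have le: "\<forall>\<^sub>F T in at_top. (norm (x T))\<^sup>2 \<le> ?V (x 0) / (l * (1 + k * T))"
      using eventually_ge_at_top[of 0] by eventually_elim (rule bound)
    have "((\<lambda>T. (norm (x T))\<^sup>2) \<longlongrightarrow> 0) at_top"
      by (rule tendsto_sandwich[OF _ le tendsto_const lim]) simp
    then have "((\<lambda>T. sqrt ((norm (x T))\<^sup>2)) \<longlongrightarrow> sqrt 0) at_top" by (rule tendsto_real_sqrt)
    then show ?thesis by (simp add: tendsto_norm_zero_iff)
  qed
  show ?thesis
    unfolding globally_asymptotically_stable_def
    using closed_loop_solution_zero[OF N] stable conv by blast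
qed

section \<open>Integrability and bound of the cost\<close>

lemma weighted_cost_quadratic_form:
  "y \<bullet> (weighted_cost N \<sigma> Q \<alpha> y *v y) = (\<Sum>i\<in>active_modes N \<sigma> y. \<alpha> i y * (y \<bullet> (Q i *v y)))"
  unfolding weighted_cost_def by (rule quadratic_form_sum) simp

text \<open>The times at which \<open>i\<close> is active form a closed set. Off \<open>Z\<close>
  the weight is continuous relative to it, and a function continuous on a measurable set and
  extended by 0 is measurable.\<close>

lemma weighted_mode_cost_measurable:
  fixes x :: "real \<Rightarrow> real^'n" and M :: "real^'n^'n"
  assumes x: "continuous_on {0..} x" and Z: "negligible Z" and i: "i \<in> {1..N}"
    and cont: "\<And>t. \<lbrakk>t \<notin> Z; 0 \<le> t; i \<in> active_modes N \<sigma> (x t)\<rbrakk> \<Longrightarrow>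
      continuous (at t within {s. 0 \<le> s \<and> i \<in> active_modes N \<sigma> (x s)}) (\<lambda>s. \<alpha> i (x s))"
  shows "(\<lambda>t. if t \<in> {s. 0 \<le> s \<and> i \<in> active_modes N \<sigma> (x s)} - Z then \<alpha> i (x t) * (x t \<bullet> (M *v x t)) else 0)
      \<in> borel_measurable lebesgue"
proof -
  let ?S = "{s. 0 \<le> s \<and> i \<in> active_modes N \<sigma> (x s)}"
  have "?S = {0..} \<inter> x -` closure {z. \<sigma> z = i}"
    using i by (auto simp: active_modes_closure)
  moreover have "closed ({0..} \<inter> x -` closure {z. \<sigma> z = i})"
    by (rule continuous_closed_preimage[OF x]) auto
  ultimately have "?S \<in> sets lebesgue" by simp
  then have S: "?S - Z \<in> sets lebesgue"
    using Z by (intro sets.Diff) (auto simp: negligible_iff_null_sets)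
  have "continuous_on (?S - Z) (\<lambda>s. \<alpha> i (x s))"
    unfolding continuous_on_eq_continuous_within
    using cont by (auto intro: continuous_within_subset)
  moreover have "continuous_on (?S - Z) x"
    by (rule continuous_on_subset[OF x]) auto
  ultimately have "continuous_on (?S - Z) (\<lambda>t. \<alpha> i (x t) * (x t \<bullet> (M *v x t)))"
    by (intro continuous_intros)
  then show ?thesis
    by (rule borel_measurable_if_I[OF continuous_imp_measurable_on_sets_lebesgue[OF _ S] S])
qed

lemma nonneg_integral_half_line_le:
  fixes f :: "real \<Rightarrow> real"
  assumes f: "\<And>T. 0 \<le> T \<Longrightarrow> f integrable_on {0..T}" "\<And>t. 0 \<le> f t"
    and b: "\<And>T. 1 \<le> T \<Longrightarrow> integral {0..T} f \<le> b"
  shows "f absolutely_integrable_on {0..}" "integral {0..} f \<le> b"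
proof -
  \<comment> \<open>The truncations start at length 1, because the bound \<open>b\<close> is
    available only from \<open>T = 1\<close> on.\<close>
  define g where "g = (\<lambda>k t. if t \<in> {0..real k + 1} then f t else 0)"
  have int: "integral {0..} (g k) = integral {0..real k + 1} f" for k
    unfolding g_def integral_restrict_Int by (simp add: Int_absorb2)
  have *: "f integrable_on {0..} \<and> (\<lambda>k. integral {0..} (g k)) \<longlonglongrightarrow> integral {0..} f"
  proof (rule monotone_convergence_increasing)
    show "g k integrable_on {0..}" for k
      using f(1)[of "real k + 1"] unfolding g_def integrable_restrict_Int by (simp add: Int_absorb2)
    show "g k t \<le> g (Suc k) t" for k t using f(2) by (auto simp: g_def)
    show "(\<lambda>k. g k t) \<longlonglongrightarrow> f t" if "t \<in> {0..}" for t
    proof (rule tendsto_eventually, rule eventually_sequentiallyI[of "nat \<lceil>t\<rceil>"])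
      fix k assume "nat \<lceil>t\<rceil> \<le> k"
      then have "t \<le> real k + 1" by linarith
      then show "g k t = f t" using that by (simp add: g_def)
    qed
    have "0 \<le> integral {0..real k + 1} f" for k
      using f by (intro Henstock_Kurzweil_Integration.integral_nonneg) auto
    then have "norm (integral {0..} (g k)) \<le> b" for k
      using b[of "real k + 1"] by (simp add: int)
    then show "bounded (range (\<lambda>k. integral {0..} (g k)))"
      by (auto simp: bounded_iff)
  qed
  then show "f absolutely_integrable_on {0..}"
    using f(2) by (intro nonnegative_absolutely_integrable_1) auto
  show "integral {0..} f \<le> b"
    by (rule LIMSEQ_le_const2[OF conjunct2[OF *]]) (use b int in auto)
qed

text \<open>The velocity inequality controls \<open>c |x|^2\<close> and the cost together.
  Discarding the nonnegative terminal value of the Lyapunov function bounds the cost on finite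
  intervals uniformly, and monotone convergence reaches the half line.\<close>

lemma closed_loop_cost_bound:
  fixes A P Q :: "nat \<Rightarrow> real^'n^'n"
  assumes N: "1 \<le> N" and P: "\<forall>i\<in>{1..N}. pos_def (P i)" and Q: "\<forall>i\<in>{1..N}. pos_semidef (Q i)" and c: "0 < c"
    and vel: "\<And>y \<xi> a. represents_velocity N A P (switching_law N P) y \<xi> a \<Longrightarrow>
      vdot P (switching_law N P y) y \<xi> \<le>
      - (c * (norm y)\<^sup>2 + (\<Sum>i\<in>active_modes N (switching_law N P) y. a i * (y \<bullet> (Q i *v y))))"
    and x: "closed_loop_solution N A P (switching_law N P) x"
    and \<alpha>: "solution_weights N A P (switching_law N P) x \<alpha>" and x0: "x 0 \<noteq> 0"
  defines "h \<equiv> \<lambda>t. x t \<bullet> (weighted_cost N (switching_law N P) Q \<alpha> (x t) *v x t)"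
  shows "h absolutely_integrable_on {0..}" "integral {0..} h < min_form N P (x 0)"
proof -
  let ?I = "\<lambda>t. active_modes N (switching_law N P) (x t)"
  let ?S = "\<lambda>i. {s. 0 \<le> s \<and> i \<in> ?I s}"
  have cont: "continuous_on {0..} x" by (rule closed_loop_solution_continuous[OF x])
  have "AE t in lebesgue. 0 \<le> t \<longrightarrow>
      (\<exists>\<xi>. (x has_vector_derivative \<xi>) (at t within {0..}) \<and>
         represents_velocity N A P (switching_law N P) (x t) \<xi> (\<lambda>i. \<alpha> i (x t)))"
    using \<alpha> unfolding solution_weights_def by (rule conjunct1)
  then obtain Z0 where Z0: "negligible Z0" "\<And>t. t \<notin> Z0 \<Longrightarrow> 0 \<le> t \<longrightarrow>
      (\<exists>\<xi>. (x has_vector_derivative \<xi>) (at t within {0..}) \<and>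
         represents_velocity N A P (switching_law N P) (x t) \<xi> (\<lambda>i. \<alpha> i (x t)))"
    by (rule AE_lebesgue_negligible) (rule that)
  have "\<forall>i\<in>{1..N}. \<exists>Z. negligible Z \<and> (\<forall>t. t \<notin> Z \<longrightarrow> 0 \<le> t \<and> i \<in> ?I t \<longrightarrow>
      continuous (at t within ?S i) (\<lambda>s. \<alpha> i (x s)))"
  proof
    fix i assume "i \<in> {1..N}"
    then have "AE t in lebesgue. 0 \<le> t \<and> i \<in> ?I t \<longrightarrow> continuous (at t within ?S i) (\<lambda>s. \<alpha> i (x s))"
      using \<alpha>[unfolded solution_weights_def, THEN conjunct2] by (rule bspec[rotated])
    then show "\<exists>Z. negligible Z \<and> (\<forall>t. t \<notin> Z \<longrightarrow> 0 \<le> t \<and> i \<in> ?I t \<longrightarrow>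
      continuous (at t within ?S i) (\<lambda>s. \<alpha> i (x s)))"
      by (rule AE_lebesgue_negligible) (iprover intro: exI conjI allI impI)
  qed
  from bchoice[OF this] obtain ZZ where ZZ: "\<forall>i\<in>{1..N}. negligible (ZZ i) \<and> (\<forall>t. t \<notin> ZZ i \<longrightarrow> 0 \<le> t \<and> i \<in> ?I t \<longrightarrow>
      continuous (at t within ?S i) (\<lambda>s. \<alpha> i (x s)))" ..
  define Z where "Z = Z0 \<union> (\<Union>i\<in>{1..N}. ZZ i)"
  have Z: "negligible Z"
    unfolding Z_def using Z0(1) ZZ by (intro negligible_Un negligible_Union) auto
  have rep: "\<exists>\<xi>. (x has_vector_derivative \<xi>) (at t within {0..}) \<and>
         represents_velocity N A P (switching_law N P) (x t) \<xi> (\<lambda>i. \<alpha> i (x t))"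
    if "t \<notin> Z" "0 \<le> t" for t
    using Z0(2)[of t] that by (simp add: Z_def)
  \<comment> \<open>The upper bound 1 provides the continuous dominating function
    \<open>B * (norm (x t))\<^sup>2\<close> of the cost.\<close>
  have \<alpha>01: "0 \<le> \<alpha> i (x t) \<and> \<alpha> i (x t) \<le> 1" if t: "t \<in> ?S i - Z" for i t
  proof -
    have a: "\<forall>i\<in>?I t. 0 \<le> \<alpha> i (x t)" "(\<Sum>i\<in>?I t. \<alpha> i (x t)) = 1"
      using rep[of t] t by (auto simp: represents_velocity_def)
    then have "\<alpha> i (x t) \<le> (\<Sum>i\<in>?I t. \<alpha> i (x t))" using t by (intro member_le_sum) auto
    with a t show ?thesis by auto
  qed
  \<comment> \<open>\<open>h\<close> is arbitrary on the null set \<open>Z\<close>; \<open>h2\<close> is its modification to \<open>0\<close> there, which is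
    measurable and nonnegative everywhere.\<close>
  define hi where "hi = (\<lambda>i t. if t \<in> ?S i - Z then \<alpha> i (x t) * (x t \<bullet> (Q i *v x t)) else 0)"
  define h2 where "h2 = (\<lambda>t. \<Sum>i=1..N. hi i t)"
  define B where "B = (\<Sum>i=1..N. onorm ((*v) (Q i)))"
  have h2_eq: "h2 t = h t" if "t \<notin> Z" "0 \<le> t" for t
  proof -
    have "h2 t = (\<Sum>i\<in>{1..N}. if i \<in> ?I t then \<alpha> i (x t) * (x t \<bullet> (Q i *v x t)) else 0)"
      using that by (auto simp: h2_def hi_def intro!: sum.cong)
    also have "\<dots> = (\<Sum>i\<in>{1..N} \<inter> ?I t. \<alpha> i (x t) * (x t \<bullet> (Q i *v x t)))"
      by (simp add: sum.inter_restrict)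
    also have "{1..N} \<inter> ?I t = ?I t" by (auto simp: active_modes_def)
    finally show ?thesis by (simp add: h_def weighted_cost_quadratic_form)
  qed
  have hi_bounds: "0 \<le> hi i t \<and> hi i t \<le> onorm ((*v) (Q i)) * (norm (x t))\<^sup>2" if i: "i \<in> {1..N}" for i t
  proof -
    have q0: "0 \<le> x t \<bullet> (Q i *v x t)" using Q i by (simp add: pos_semidef_def)
    have q1: "x t \<bullet> (Q i *v x t) \<le> onorm ((*v) (Q i)) * (norm (x t))\<^sup>2"
      using bilinear_matrix_bound[of "x t" "Q i" "x t"] by (simp add: power2_eq_square mult.assoc)
    show ?thesis
    proof (cases "t \<in> ?S i - Z")
      case True
      then have "\<alpha> i (x t) * (x t \<bullet> (Q i *v x t)) \<le> 1 * (x t \<bullet> (Q i *v x t))"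
        using \<alpha>01[OF True] q0 by (intro mult_right_mono) auto
      then have "\<alpha> i (x t) * (x t \<bullet> (Q i *v x t)) \<le> onorm ((*v) (Q i)) * (norm (x t))\<^sup>2"
        using q1 by linarith
      with True \<alpha>01[OF True] q0 show ?thesis by (simp add: hi_def)
    next
      case False
      then have "hi i t = 0" unfolding hi_def by (rule if_not_P)
      with q0 q1 show ?thesis by linarith
    qed
  qed
  have h2_nonneg: "0 \<le> h2 t" for t
    unfolding h2_def using hi_bounds by (intro sum_nonneg) auto
  have h2_le: "h2 t \<le> B * (norm (x t))\<^sup>2" for t
    unfolding h2_def B_def sum_distrib_right using hi_bounds by (intro sum_mono) auto
  have contT: "continuous_on {0..T} x" for T
    by (rule continuous_on_subset[OF cont]) auto
  have "hi i \<in> borel_measurable lebesgue" if i: "i \<in> {1..N}" for i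
    unfolding hi_def
  proof (rule weighted_mode_cost_measurable[OF cont Z i])
    fix t assume "t \<notin> Z" "0 \<le> t" "i \<in> ?I t"
    then show "continuous (at t within ?S i) (\<lambda>s. \<alpha> i (x s))" using ZZ i by (auto simp: Z_def)
  qed
  then have "h2 \<in> borel_measurable lebesgue"
    unfolding h2_def by (intro borel_measurable_sum) auto
  then have h2_meas: "h2 \<in> borel_measurable (lebesgue_on {0..T})" for T
    by (rule measurable_restrict_space1)
  have h2_int: "h2 integrable_on {0..T}" for T
  proof (rule measurable_bounded_by_integrable_imp_integrable[OF h2_meas])
    show "(\<lambda>t. B * (norm (x t))\<^sup>2) integrable_on {0..T}"
      by (intro integrable_continuous_real continuous_intros contT)
    show "norm (h2 t) \<le> B * (norm (x t))\<^sup>2" for t using h2_nonneg[of t] h2_le[of t] by simp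
  qed auto
  let ?n = "\<lambda>t. c * (norm (x t))\<^sup>2"
  have n_int: "?n integrable_on {0..T}" for T
    by (intro integrable_continuous_real continuous_intros contT)
  have "AE t in lebesgue. t \<notin> Z" using Z by (intro AE_not_in) (simp add: negligible_iff_null_sets)
  then have ae: "AE t in lebesgue. 0 \<le> t \<longrightarrow> (\<exists>\<xi>. (x has_vector_derivative \<xi>) (at t within {0..}) \<and>
      vdot P (switching_law N P (x t)) (x t) \<xi> \<le> - (?n t + h2 t))"
  proof eventually_elim
    case (elim t)
    show ?case
    proof
      assume t: "0 \<le> t"
      obtain \<xi> where \<xi>: "(x has_vector_derivative \<xi>) (at t within {0..})"
        "represents_velocity N A P (switching_law N P) (x t) \<xi> (\<lambda>i. \<alpha> i (x t))"
        using rep[OF elim t] by blast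
      from vel[OF \<xi>(2)] have "vdot P (switching_law N P (x t)) (x t) \<xi> \<le> - (?n t + h2 t)"
        unfolding h2_eq[OF elim t] h_def weighted_cost_quadratic_form .
      with \<xi>(1) show "\<exists>\<xi>. (x has_vector_derivative \<xi>) (at t within {0..}) \<and>
        vdot P (switching_law N P (x t)) (x t) \<xi> \<le> - (?n t + h2 t)" by blast
    qed
  qed
  have V0: "0 \<le> min_form N P y" for y
  proof -
    have s: "switching_law N P y \<in> {1..N}" "y \<bullet> (P (switching_law N P y) *v y) = min_form N P y"
      by (rule switching_law_attains[OF N])+
    have "0 \<le> y \<bullet> (P (switching_law N P y) *v y)"
      using P s(1) by (cases "y = 0") (auto simp: pos_def_def less_imp_le)
    then show ?thesis unfolding s(2) .
  qed
  \<comment> \<open>The subtracted integral is part of every integral over \<open>{0..T}\<close>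
    with \<open>T \<ge> 1\<close>; a margin independent of \<open>T\<close> keeps the inequality
    strict in the limit.\<close>
  define b where "b = min_form N P (x 0) - integral {0..1} ?n"
  have le_b: "integral {0..T} h2 \<le> b" if T: "1 \<le> T" for T
  proof -
    have "min_form N P (x T) + integral {0..T} (\<lambda>t. ?n t + h2 t) \<le> min_form N P (x 0)"
      by (rule min_form_decrease[OF N x _ _ _ ae]) (use T n_int h2_int in \<open>auto intro: integrable_add\<close>)
    moreover have "integral {0..T} (\<lambda>t. ?n t + h2 t) = integral {0..T} ?n + integral {0..T} h2"
      by (rule Henstock_Kurzweil_Integration.integral_add[OF n_int h2_int])
    moreover have "integral {0..1} ?n \<le> integral {0..T} ?n"
      by (rule integral_subset_le) (use T n_int c in auto)
    ultimately show ?thesis using V0[of "x T"] by (simp add: b_def)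
  qed
  have h2_ai: "h2 absolutely_integrable_on {0..}" and h2_b: "integral {0..} h2 \<le> b"
    using nonneg_integral_half_line_le[of h2 b] h2_int h2_nonneg le_b by auto
  show "h absolutely_integrable_on {0..}"
    by (rule absolutely_integrable_spike[OF h2_ai Z]) (use h2_eq in auto)
  have "integral {0..} h = integral {0..} h2"
    by (rule integral_spike[OF Z]) (use h2_eq in auto)
  moreover have "0 < integral {0..1} ?n"
  proof -
    have "0 \<le> integral {0..1} ?n" by (rule Henstock_Kurzweil_Integration.integral_nonneg[OF n_int]) (use c in auto)
    moreover have "integral {0..1} ?n \<noteq> 0"
    proof
      assume *: "integral {0..1} ?n = 0"
      \<comment> \<open>A continuous nonnegative integrand with integral 0 vanishes throughout, in
        particular at \<open>t = 0\<close>, against \<open>x 0 \<noteq> 0\<close>.\<close>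
      have "continuous_on {0..1} ?n" by (intro continuous_intros contT)
      then have "\<forall>t\<in>{0..1}. ?n t = 0"
        using integral_eq_0_iff[of 0 1 ?n] * c by simp
      then show False using c x0 by auto
    qed
    ultimately show ?thesis by linarith
  qed
  ultimately show "integral {0..} h < min_form N P (x 0)" using h2_b by (simp add: b_def)
qed

text \<open>A solution starting at 0 stays there, and both sides of the cost bound are 0; a strict
  inequality therefore concerns \<open>x 0 \<noteq> 0\<close>. Integrability is asserted separately
  because the Lebesgue integral of a nonintegrable function is 0 by convention, which would make the
  bound empty.\<close>

theorem propositionA1:
  fixes N :: nat
    and A P Q :: "nat \<Rightarrow> real^'n^'n"
    and \<pi> :: "nat \<Rightarrow> nat \<Rightarrow> real"
  assumes "1 \<le> N"
    and "\<forall>i\<in>{1..N}. pos_def (P i)"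
    and "\<forall>i\<in>{1..N}. pos_semidef (Q i)"
    and "\<pi> \<in> Metzler_zero_colsum N"
    and "\<forall>i\<in>{1..N}. neg_def (transpose (A i) ** P i + P i ** A i + (\<Sum>j=1..N. \<pi> j i *\<^sub>R P j) + Q i)"
  shows "globally_asymptotically_stable (closed_loop_solution N A P (switching_law N P)) 0 \<and>
    (\<forall>x \<alpha>. closed_loop_solution N A P (switching_law N P) x \<and>
        solution_weights N A P (switching_law N P) x \<alpha> \<and> x 0 \<noteq> 0 \<longrightarrow>
      set_integrable lebesgue {0..}
        (\<lambda>t. x t \<bullet> (weighted_cost N (switching_law N P) Q \<alpha> (x t) *v x t)) \<and>
      set_lebesgue_integral lebesgue {0..}
        (\<lambda>t. x t \<bullet> (weighted_cost N (switching_law N P) Q \<alpha> (x t) *v x t))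
        < Min ((\<lambda>i. x 0 \<bullet> (P i *v x 0)) ` {1..N}))"
proof -
  obtain c where c: "0 < c" and vel: "\<And>y \<xi> a. represents_velocity N A P (switching_law N P) y \<xi> a \<Longrightarrow>
      vdot P (switching_law N P y) y \<xi> \<le>
      - (c * (norm y)\<^sup>2 + (\<Sum>i\<in>active_modes N (switching_law N P) y. a i * (y \<bullet> (Q i *v y))))"
    by (rule lyapunov_velocity_inequality[OF assms(1,4,5)], rule that)
  show ?thesis
  proof (intro conjI allI impI)
    show "globally_asymptotically_stable (closed_loop_solution N A P (switching_law N P)) 0"
      by (rule closed_loop_globally_asymptotically_stable[OF assms(1,2) c
            closed_loop_decay[OF assms(1,3) vel]])
  next
    fix x \<alpha>
    assume "closed_loop_solution N A P (switching_law N P) x \<and>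
        solution_weights N A P (switching_law N P) x \<alpha> \<and> x 0 \<noteq> 0"
    then have *: "closed_loop_solution N A P (switching_law N P) x"
      "solution_weights N A P (switching_law N P) x \<alpha>" "x 0 \<noteq> 0" by auto
    let ?h = "\<lambda>t. x t \<bullet> (weighted_cost N (switching_law N P) Q \<alpha> (x t) *v x t)"
    note cost = closed_loop_cost_bound[OF assms(1,2,3) c vel *]
    show "set_integrable lebesgue {0..} ?h" by (rule cost(1))
    then show "set_lebesgue_integral lebesgue {0..} ?h < Min ((\<lambda>i. x 0 \<bullet> (P i *v x 0)) ` {1..N})"
      using cost(2) by (simp add: set_lebesgue_integral_eq_integral(2) min_form_def)
  qed
qed

end
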